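(* Let $k$ be an algebraically closed field of characteristic $0$, $A=k[x,y]$, $V_1=k[x,y]/(y)$ (a line through the origin) and $V_2=k[x,y]/(x,y)$ (a point). Then the versal base space $H$ (as defined in the context) of the non-commutative deformations of the pair $\{V_1,V_2\}$, in which the line $V_1$ is only allowed to deform to lines through the origin, is $$H\simeq\begin{pmatrix}k[t_{11}]&t_{12}\\ t_{21}&k\langle t_{22}(1),t_{22}(2)\rangle\end{pmatrix}\Big/\bigl(t_{22}(2)t_{22}(1)-t_{22}(1)t_{22}(2)-t_{21}t_{12},\ \ t_{22}(2)t_{21}+t_{22}(1)t_{21}t_{11}\bigr),$$ where the matrix denotes the free $k^2$-algebra on the generators $t_{11},t_{12},t_{21},t_{22}(1),t_{22}(2)$, and the quotient is by the two-sided ideal generated by the two displayed elements (which lie in the $(2,2)$- and $(2,1)$-entry respectively).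
   Context: **Free $k^2$-algebra.** $S=\begin{pmatrix}k\langle t_{11}\rangle&t_{12}\\ t_{21}&k\langle t_{22}(1),t_{22}(2)\rangle\end{pmatrix}$ is the tensor algebra over $k^2=ke_1\times ke_2$ of the $k^2$-bimodule with $k$-basis $t_{11},t_{12},t_{21},t_{22}(1),t_{22}(2)$, where $t_{ij}(l)=e_it_{ij}(l)e_j$. Let $\mathfrak m\subset S$ be the two-sided ideal generated by these variables, so $S/\mathfrak m=k^2$. **Pointed algebras and deformations.** $a_2$ is the category of $k$-algebras $R$ with $k$-algebra maps $k^2\to R\xrightarrow{\rho}k^2$ composing to the identity, such that $\ker\rho$ is nilpotent and $R$ is Artinian; write $R_{ij}=e_iRe_j$. Put $V=V_1\oplus V_2$. A deformation of $\{V_1,V_2\}$ to $R\in a_2$ is an $R\otimes_kA$-module $V_R$ (left $R$-module with commuting right $A$-action), flat over $R$ in the sense that $V_R\cong R\otimes_{k^2}V=(R_{ij}\otimes_kV_j)$ as left $R$-module, with a given isomorphism $k^2\otimes_RV_R\cong V$; equivalence is isomorphism compatible with the maps to $V$. If $R'\twoheadrightarrow R$ is a surjection in $a_2$ with kernel $I$ satisfying $I\cdot\ker\rho'=\ker\rho'\cdot I=0$ (where $\rho':R'\to k^2$), a deformation $V_R$ has an obstruction class $o\in\bigl(\mathrm{Ext}^2_A(V_i,V_j)\otimes_kI_{ij}\bigr)_{i,j}$, which vanishes if and only if $V_R$ lifts to $R'$. **Tangent directions used.** Use the free resolutions $0\leftarrow V_1\leftarrow A\xleftarrow{\,y\,}A\leftarrow0$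 and $0\leftarrow V_2\leftarrow A\xleftarrow{(x\ y)}A^2\xleftarrow{\binom{y}{-x}}A\leftarrow0$ to compute $\mathrm{Ext}^1_A(V_i,V_j)$. One considers only the tangent direction $x\in V_1=\mathrm{Ext}^1_A(V_1,V_1)$ for the line (deformations of the line to lines), corresponding to $t_{11}$; together with the generator $1$ of $\mathrm{Ext}^1_A(V_1,V_2)=V_2\cong k$ for $t_{12}$; the class of $(1,0)\in V_1^2$ in $\mathrm{Ext}^1_A(V_2,V_1)\cong k$ for $t_{21}$; and $(1,0),(0,1)\in V_2^2=\mathrm{Ext}^1_A(V_2,V_2)$ for $t_{22}(1),t_{22}(2)$. These classes define a deformation $V_{H_2}$ of $\{V_1,V_2\}$ to $H_2=S/\mathfrak m^2$ (first-order part $\sum t_{ij}(l)\otimes[\text{corresponding class}]$). **Versal base space.** It is obtained by the following obstruction calculus. Put $J_2=\mathfrak m^2$. Given $n\ge2$, $H_n=S/J_n$ with $J_n\supseteq\mathfrak m^n$ and a deformation $V_{H_n}$ to $H_n$, put $R_{n+1}=S/(\mathfrak m^{n+1}+\mathfrak mJ_n+J_n\mathfrak m)$, let $H_{n+1}=S/J_{n+1}$ be the quotient of $R_{n+1}$ by the smallest ideal contained in $\ker(R_{n+1}\to H_n)$ modulo which the obstruction for lifting $V_{H_n}$ to $R_{n+1}$ vanishes, and choose a lifting $V_{H_{n+1}}$ of $V_{H_n}$ to $H_{n+1}$. The liftings are chosen such that the line deforms only to lines through the origin: setting $t_{12}=t_{21}=0$, the induced deformation of $V_1$ in the $(1,1)$-entry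 over $k[t_{11}]/(t_{11}^n)$ is of the form $(k[t_{11}]/(t_{11}^n))[x,y]/(y+u_nx)$ with $u_n\in k[t_{11}]/(t_{11}^n)$. The versal base space is an algebra $H=S/J$, with $J\subseteq\mathfrak m^2$ a two-sided ideal, such that $J+\mathfrak m^n=J_n$ for all $n\ge2$, for such a choice of liftings; thus $\varprojlim H_n$ is the $\mathfrak m$-adic completion of $H$. *)

theory Defs
  imports
    "HOL-Library.Product_Plus"
    "HOL-Computational_Algebra.Polynomial"
    "HOL-Algebra.Algebraic_Closure_Type"
    "HOL-Algebra.Ideal_Product"
    "HOL-Algebra.Generated_Groups"
    "HOL-Algebra.Module"
begin

section \<open>The free algebra over $k^2$ on five generators\<close>

text \<open>
  The tensor algebra \<open>S\<close> has as \<open>k\<close>-basis the idempotents \<open>e\<^sub>1, e\<^sub>2\<close> and the composable words in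
  the generators \<open>t\<^sub>i\<^sub>j(l) = e\<^sub>i t\<^sub>i\<^sub>j(l) e\<^sub>j\<close>. A basis element is encoded as a pair \<open>(i, ws)\<close> of a row
  index and a word; \<open>(i, [])\<close> is \<open>e\<^sub>i\<close>. The row index is redundant if \<open>ws\<close> is nonempty.
\<close>

datatype idx = N1 | N2

datatype gen = T11 | T12 | T21 | T22_1 | T22_2

fun row :: "gen \<Rightarrow> idx" where
  "row T11 = N1" | "row T12 = N1" | "row T21 = N2" | "row T22_1 = N2" | "row T22_2 = N2"

fun col :: "gen \<Rightarrow> idx" where
  "col T11 = N1" | "col T12 = N2" | "col T21 = N1" | "col T22_1 = N2" | "col T22_2 = N2"

fun composable :: "idx \<Rightarrow> gen list \<Rightarrow> bool" where
  "composable i [] = True"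
| "composable i (a # ws) = (row a = i \<and> composable (col a) ws)"

fun last_idx :: "idx \<Rightarrow> gen list \<Rightarrow> idx" where
  "last_idx i [] = i"
| "last_idx i (a # ws) = last_idx (col a) ws"

lemma composable_append: "composable i (u @ v) \<longleftrightarrow> composable i u \<and> composable (last_idx i u) v"
  by (induction u arbitrary: i) auto

lemma last_idx_append: "last_idx i (u @ v) = last_idx (last_idx i u) v"
  by (induction u arbitrary: i) auto

lemma finite_trivial_words: "finite {p :: idx \<times> gen list. snd p = []}"
proof (rule finite_subset)
  show "{p :: idx \<times> gen list. snd p = []} \<subseteq> {(N1, []), (N2, [])}"
    by auto (metis idx.exhaust)
qed simp

typedef (overloaded) 'k free_alg =
  "{f :: idx \<times> gen list \<Rightarrow> 'k::zero.
      finite {p. f p \<noteq> 0} \<and> (\<forall>i ws. \<not> composable i ws \<longrightarrow> f (i, ws) = 0)}"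
  morphisms word_coeff Abs_free_alg
  by (rule exI[of _ "\<lambda>_. 0"]) simp

setup_lifting type_definition_free_alg

instantiation free_alg :: (comm_ring_1) ring_1
begin

lift_definition zero_free_alg :: "'a free_alg" is "\<lambda>_. 0"
  by simp

lift_definition one_free_alg :: "'a free_alg" is "\<lambda>p. if snd p = [] then 1 else 0"
  using finite_trivial_words by auto

lift_definition plus_free_alg :: "'a free_alg \<Rightarrow> 'a free_alg \<Rightarrow> 'a free_alg" is "\<lambda>f g p. f p + g p"
proof -
  fix f g :: "idx \<times> gen list \<Rightarrow> 'a"
  assume f: "finite {p. f p \<noteq> 0} \<and> (\<forall>i ws. \<not> composable i ws \<longrightarrow> f (i, ws) = 0)"
    and g: "finite {p. g p \<noteq> 0} \<and> (\<forall>i ws. \<not> composable i ws \<longrightarrow> g (i, ws) = 0)"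
  have "{p. f p + g p \<noteq> 0} \<subseteq> {p. f p \<noteq> 0} \<union> {p. g p \<noteq> 0}"
    by auto
  then have "finite {p. f p + g p \<noteq> 0}"
    using f g by (meson finite_UnI finite_subset)
  with f g show "finite {p. f p + g p \<noteq> 0} \<and>
      (\<forall>i ws. \<not> composable i ws \<longrightarrow> f (i, ws) + g (i, ws) = 0)"
    by simp
qed

lift_definition uminus_free_alg :: "'a free_alg \<Rightarrow> 'a free_alg" is "\<lambda>f p. - f p"
  by simp

lift_definition minus_free_alg :: "'a free_alg \<Rightarrow> 'a free_alg \<Rightarrow> 'a free_alg" is "\<lambda>f g p. f p - g p"
proof -
  fix f g :: "idx \<times> gen list \<Rightarrow> 'a"
  assume f: "finite {p. f p \<noteq> 0} \<and> (\<forall>i ws. \<not> composable i ws \<longrightarrow> f (i, ws) = 0)"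
    and g: "finite {p. g p \<noteq> 0} \<and> (\<forall>i ws. \<not> composable i ws \<longrightarrow> g (i, ws) = 0)"
  have "{p. f p - g p \<noteq> 0} \<subseteq> {p. f p \<noteq> 0} \<union> {p. g p \<noteq> 0}"
    by auto
  then have "finite {p. f p - g p \<noteq> 0}"
    using f g by (meson finite_UnI finite_subset)
  with f g show "finite {p. f p - g p \<noteq> 0} \<and>
      (\<forall>i ws. \<not> composable i ws \<longrightarrow> f (i, ws) - g (i, ws) = 0)"
    by simp
qed

lift_definition times_free_alg :: "'a free_alg \<Rightarrow> 'a free_alg \<Rightarrow> 'a free_alg" is
  "\<lambda>f g (i, ws). \<Sum>l\<le>length ws. f (i, take l ws) * g (last_idx i (take l ws), drop l ws)"
proof -
  fix f g :: "idx \<times> gen list \<Rightarrow> 'a"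
  assume f: "finite {p. f p \<noteq> 0} \<and> (\<forall>i ws. \<not> composable i ws \<longrightarrow> f (i, ws) = 0)"
    and g: "finite {p. g p \<noteq> 0} \<and> (\<forall>i ws. \<not> composable i ws \<longrightarrow> g (i, ws) = 0)"
  let ?h = "\<lambda>(i, ws). \<Sum>l\<le>length ws. f (i, take l ws) * g (last_idx i (take l ws), drop l ws)"
  have "{p. ?h p \<noteq> 0} \<subseteq> (\<lambda>(p, q). (fst p, snd p @ snd q)) ` ({p. f p \<noteq> 0} \<times> {p. g p \<noteq> 0})"
  proof
    fix p assume p: "p \<in> {p. ?h p \<noteq> 0}"
    obtain i ws where pi: "p = (i, ws)" by fastforce
    from p pi obtain l where l: "f (i, take l ws) * g (last_idx i (take l ws), drop l ws) \<noteq> 0"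
      by (auto elim: sum.not_neutral_contains_not_neutral)
    then have "f (i, take l ws) \<noteq> 0" "g (last_idx i (take l ws), drop l ws) \<noteq> 0"
      by auto
    then show "p \<in> (\<lambda>(p, q). (fst p, snd p @ snd q)) ` ({p. f p \<noteq> 0} \<times> {p. g p \<noteq> 0})"
      unfolding pi
      by (intro image_eqI[of _ _ "((i, take l ws), (last_idx i (take l ws), drop l ws))"]) auto
  qed
  then have "finite {p. ?h p \<noteq> 0}"
    using f g by (meson finite_SigmaI finite_imageI finite_subset)
  moreover have "?h (i, ws) = 0" if "\<not> composable i ws" for i ws
  proof -
    have "\<not> composable i (take l ws) \<or> \<not> composable (last_idx i (take l ws)) (drop l ws)" for l
      using that composable_append[of i "take l ws" "drop l ws"] by simp
    then have "f (i, take l ws) * g (last_idx i (take l ws), drop l ws) = 0" for l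
      using f g by (metis mult_zero_left mult_zero_right)
    then show ?thesis by simp
  qed
  ultimately show "finite {p. ?h p \<noteq> 0} \<and> (\<forall>i ws. \<not> composable i ws \<longrightarrow> ?h (i, ws) = 0)"
    by blast
qed

instance
proof
  fix a b c :: "'a free_alg"
  show "a * b * c = a * (b * c)"
  proof (intro word_coeff_inject[THEN iffD1] ext)
    fix p :: "idx \<times> gen list"
    obtain i ws where p: "p = (i, ws)" by fastforce
    let ?f = "word_coeff a" and ?g = "word_coeff b" and ?h = "word_coeff c"
    let ?n = "length ws"
    let ?F = "\<lambda>j l. ?f (i, take j ws) * ?g (last_idx i (take j ws), take (l - j) (drop j ws))
       * ?h (last_idx i (take l ws), drop l ws)"
    have "(\<Sum>l\<le>?n. (\<Sum>j\<le>length (take l ws). ?f (i, take j (take l ws))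
            * ?g (last_idx i (take j (take l ws)), drop j (take l ws)))
            * ?h (last_idx i (take l ws), drop l ws))
        = (\<Sum>l\<le>?n. \<Sum>j\<le>l. ?F j l)"
    proof (intro sum.cong refl)
      fix l assume "l \<in> {..?n}"
      then have len: "length (take l ws) = l" by simp
      have "?f (i, take j (take l ws)) * ?g (last_idx i (take j (take l ws)), drop j (take l ws))
          * ?h (last_idx i (take l ws), drop l ws) = ?F j l" if "j \<in> {..l}" for j
        using that by (simp add: min_def drop_take)
      then show "(\<Sum>j\<le>length (take l ws). ?f (i, take j (take l ws))
            * ?g (last_idx i (take j (take l ws)), drop j (take l ws)))
            * ?h (last_idx i (take l ws), drop l ws) = (\<Sum>j\<le>l. ?F j l)"
        unfolding sum_distrib_right len by (rule sum.cong[OF refl])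
    qed
    also have "\<dots> = (\<Sum>(l, j)\<in>Sigma {..?n} (\<lambda>l. {..l}). ?F j l)"
      by (simp add: sum.Sigma)
    also have "\<dots> = (\<Sum>(j, m)\<in>Sigma {..?n} (\<lambda>j. {..?n - j}). ?F j (j + m))"
      by (rule sum.reindex_bij_witness[of _ "\<lambda>(j, m). (j + m, j)" "\<lambda>(l, j). (j, l - j)"]) auto
    also have "\<dots> = (\<Sum>j\<le>?n. \<Sum>m\<le>?n - j. ?F j (j + m))"
      by (simp add: sum.Sigma)
    also have "\<dots> = (\<Sum>j\<le>?n. ?f (i, take j ws) * (\<Sum>m\<le>length (drop j ws).
            ?g (last_idx i (take j ws), take m (drop j ws))
            * ?h (last_idx (last_idx i (take j ws)) (take m (drop j ws)), drop m (drop j ws))))"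
    proof (intro sum.cong refl)
      fix j
      have "?F j (j + m) = ?f (i, take j ws) * (?g (last_idx i (take j ws), take m (drop j ws))
          * ?h (last_idx (last_idx i (take j ws)) (take m (drop j ws)), drop m (drop j ws)))" for m
      proof -
        have "last_idx i (take (j + m) ws) = last_idx (last_idx i (take j ws)) (take m (drop j ws))"
          by (simp only: take_add last_idx_append)
        moreover have "drop (j + m) ws = drop m (drop j ws)"
          by (simp only: drop_drop add.commute)
        ultimately show ?thesis
          by (simp only: mult.assoc add_diff_cancel_left')
      qed
      then show "(\<Sum>m\<le>?n - j. ?F j (j + m)) = ?f (i, take j ws) * (\<Sum>m\<le>length (drop j ws).
            ?g (last_idx i (take j ws), take m (drop j ws))
            * ?h (last_idx (last_idx i (take j ws)) (take m (drop j ws)), drop m (drop j ws)))"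
        by (simp only: sum_distrib_left length_drop)
    qed
    finally show "word_coeff (a * b * c) p = word_coeff (a * (b * c)) p"
      unfolding times_free_alg.rep_eq p prod.case .
  qed
  show "1 * a = a"
  proof (transfer, rule ext, clarify)
    fix f :: "idx \<times> gen list \<Rightarrow> 'a" and i :: idx and ws :: "gen list"
    have "(\<Sum>l\<le>length ws. (if take l ws = [] then 1 else 0) * f (last_idx i (take l ws), drop l ws))
        = (\<Sum>l\<le>length ws. if l = 0 then f (i, ws) else 0)"
      by (intro sum.cong refl) auto
    then show "(\<Sum>l\<le>length ws. (if snd (i, take l ws) = [] then 1 else 0)
        * f (last_idx i (take l ws), drop l ws)) = f (i, ws)"
      by (simp cong: if_cong)
  qed
  show "a * 1 = a"
  proof (transfer, rule ext, clarify)
    fix f :: "idx \<times> gen list \<Rightarrow> 'a" and i :: idx and ws :: "gen list"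
    have "(\<Sum>l\<le>length ws. f (i, take l ws) * (if drop l ws = [] then 1 else 0))
        = (\<Sum>l\<le>length ws. if l = length ws then f (i, ws) else 0)"
      by (intro sum.cong refl) auto
    then show "(\<Sum>l\<le>length ws. f (i, take l ws) *
        (if snd (last_idx i (take l ws), drop l ws) = [] then 1 else 0)) = f (i, ws)"
      by (simp cong: if_cong)
  qed
  show "(a + b) * c = a * c + b * c"
    by transfer (auto simp: fun_eq_iff distrib_right sum.distrib)
  show "a * (b + c) = a * b + a * c"
    by transfer (auto simp: fun_eq_iff distrib_left sum.distrib)
  show "a + b + c = a + (b + c)" by transfer (simp add: add.assoc)
  show "a + b = b + a" by transfer (simp add: add.commute)
  show "0 + a = a" by transfer simp
  show "- a + a = 0" by transfer simp
  show "a - b = a + - b" by transfer simp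
  show "(0 :: 'a free_alg) \<noteq> 1"
  proof
    assume "(0 :: 'a free_alg) = 1"
    then have "word_coeff (0 :: 'a free_alg) (N1, []) = word_coeff 1 (N1, [])" by simp
    then show False by (simp add: zero_free_alg.rep_eq one_free_alg.rep_eq)
  qed
qed

end

lift_definition idem :: "idx \<Rightarrow> 'k::comm_ring_1 free_alg" is
  "\<lambda>i p. if p = (i, []) then 1 else 0"
  by auto

lift_definition tvar :: "gen \<Rightarrow> 'k::comm_ring_1 free_alg" is
  "\<lambda>a p. if p = (row a, [a]) then 1 else 0"
  by auto

lift_definition scalar :: "'k::comm_ring_1 \<Rightarrow> 'k free_alg" is
  "\<lambda>c p. if snd p = [] then c else 0"
  using finite_trivial_words by auto

lemma tvar_corners: "idem (row a) * tvar a = (tvar a :: 'k::comm_ring_1 free_alg)"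
    "tvar a * idem (col a) = (tvar a :: 'k free_alg)"
proof -
  have "word_coeff (idem (row a) * tvar a) (i, ws) = word_coeff (tvar a :: 'k free_alg) (i, ws)" for i ws
  proof -
    have "(\<Sum>l\<le>length ws. (if (i, take l ws) = (row a, []) then 1 else 0)
          * (if (last_idx i (take l ws), drop l ws) = (row a, [a]) then 1 else 0 :: 'k))
        = (\<Sum>l\<le>length ws. if l = 0 then if (i, ws) = (row a, [a]) then 1 else 0 else 0)"
      by (intro sum.cong refl) auto
    then show ?thesis
      by (simp add: times_free_alg.rep_eq idem.rep_eq tvar.rep_eq cong: if_cong)
  qed
  then show "idem (row a) * tvar a = (tvar a :: 'k free_alg)"
    by (auto simp flip: word_coeff_inject)
  have "word_coeff (tvar a * idem (col a)) (i, ws) = word_coeff (tvar a :: 'k free_alg) (i, ws)" for i ws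
  proof -
    have "(\<Sum>l\<le>length ws. (if (i, take l ws) = (row a, [a]) then 1 else 0)
          * (if (last_idx i (take l ws), drop l ws) = (col a, []) then 1 else 0 :: 'k))
        = (\<Sum>l\<le>length ws. if l = length ws then if (i, ws) = (row a, [a]) then 1 else 0 else 0)"
      by (intro sum.cong refl) auto
    then show ?thesis
      by (simp add: times_free_alg.rep_eq idem.rep_eq tvar.rep_eq cong: if_cong)
  qed
  then show "tvar a * idem (col a) = (tvar a :: 'k free_alg)"
    by (auto simp flip: word_coeff_inject)
qed

abbreviation free_ring :: "'k::comm_ring_1 free_alg ring" where
  "free_ring \<equiv> ring_of_type_algebra"

lemma ring_free_ring: "ring (free_ring :: 'k::comm_ring_1 free_alg ring)"
proof -
  have "\<exists>y. x + y = 0" for x :: "'k free_alg"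
    using add.right_inverse by blast
  then show ?thesis
    unfolding ring_of_type_algebra_def
    by unfold_locales (auto simp: algebra_simps Units_def)
qed

definition aug :: "'k::comm_ring_1 free_alg set" where
  "aug = Idl\<^bsub>free_ring\<^esub> (range tvar)"

primrec aug_pow :: "nat \<Rightarrow> 'k::comm_ring_1 free_alg set" where
  "aug_pow 0 = UNIV"
| "aug_pow (Suc n) = aug \<cdot>\<^bsub>free_ring\<^esub> aug_pow n"


section \<open>The modules $V_1$ and $V_2$ and their first extension groups\<close>

text \<open>
  \<open>A = k[x,y]\<close> is the type \<open>'k poly poly\<close>, with \<open>y\<close> the outer variable. \<open>V\<^sub>1 = A/(y)\<close> is identified
  with \<open>k[x]\<close> and \<open>V\<^sub>2 = A/(x,y)\<close> with \<open>k\<close>, so that \<open>V = V\<^sub>1 \<oplus> V\<^sub>2\<close> is the type \<open>'k poly \<times> 'k\<close>;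
  the left action of \<open>k\<^sup>2\<close> on \<open>V\<close> is made an action of \<open>S\<close> via \<open>S \<rightarrow> S/\<mm> = k\<^sup>2\<close>.
\<close>

abbreviation (input) xA :: "'k::field poly poly" where "xA \<equiv> [:[:0, 1:]:]"
abbreviation (input) yA :: "'k::field poly poly" where "yA \<equiv> [:0, 1:]"

definition actV :: "'k::field poly \<times> 'k \<Rightarrow> 'k poly poly \<Rightarrow> 'k poly \<times> 'k" where
  "actV v a = (fst v * poly a 0, snd v * poly (poly a 0) 0)"

lemma annihilator_V1: "poly a 0 = 0 \<longleftrightarrow> (yA :: 'k::field poly poly) dvd a"
  by (simp add: poly_eq_0_iff_dvd)

lemma annihilator_V2:
  "poly (poly a 0) 0 = 0 \<longleftrightarrow> (\<exists>b c. a = xA * b + yA * c)" for a :: "'k::field poly poly"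
proof
  assume *: "poly (poly a 0) 0 = 0"
  obtain p q where a: "a = pCons p q" by (cases a)
  from * a have "[:0, 1:] dvd p" by (simp add: poly_eq_0_iff_dvd)
  then obtain r where "p = [:0, 1:] * r" by (auto elim: dvdE)
  with a have "a = xA * [:r:] + yA * q" by simp
  then show "\<exists>b c. a = xA * b + yA * c" by blast
next
  assume "\<exists>b c. a = xA * b + yA * c"
  then show "poly (poly a 0) 0 = 0" by auto
qed

fun partV :: "idx \<Rightarrow> ('k::field poly \<times> 'k) set" where
  "partV N1 = UNIV \<times> {0}"
| "partV N2 = {0} \<times> UNIV"

text \<open>
  \<open>Ext\<^sup>1\<^sub>A(V\<^sub>i, V\<^sub>j)\<close> is computed by the resolution \<open>0 \<leftarrow> V\<^sub>i \<leftarrow> A \<leftarrow> A\<^bsup>rk1 i\<^esup> \<leftarrow> A\<^bsup>rk2 i\<^esup> \<leftarrow> 0\<close>: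
  \<open>d1 i r\<close> is the image of the \<open>r\<close>-th basis vector in \<open>A\<close>, and \<open>d2 i q r\<close> the \<open>r\<close>-th coordinate of
  the image of the \<open>q\<close>-th basis vector. A 1-cochain is the family of its values on the basis of
  \<open>A\<^bsup>rk1 i\<^esup>\<close> (only the arguments \<open>r < rk1 i\<close> matter).
\<close>

fun rk1 :: "idx \<Rightarrow> nat" where "rk1 N1 = 1" | "rk1 N2 = 2"
fun rk2 :: "idx \<Rightarrow> nat" where "rk2 N1 = 0" | "rk2 N2 = 1"

fun d1 :: "idx \<Rightarrow> nat \<Rightarrow> 'k::field poly poly" where
  "d1 N1 r = yA"
| "d1 N2 r = (if r = 0 then xA else yA)"

fun d2 :: "idx \<Rightarrow> nat \<Rightarrow> nat \<Rightarrow> 'k::field poly poly" where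
  "d2 N1 q r = 0"
| "d2 N2 q r = (if r = 0 then yA else - xA)"

definition cocycle1 :: "idx \<Rightarrow> idx \<Rightarrow> (nat \<Rightarrow> 'k::field poly \<times> 'k) \<Rightarrow> bool" where
  "cocycle1 i j \<zeta> \<longleftrightarrow> (\<forall>r<rk1 i. \<zeta> r \<in> partV j) \<and>
     (\<forall>q<rk2 i. (\<Sum>r<rk1 i. actV (\<zeta> r) (d2 i q r)) = 0)"

definition ext1_class ::
    "idx \<Rightarrow> idx \<Rightarrow> (nat \<Rightarrow> 'k::field poly \<times> 'k) \<Rightarrow> (nat \<Rightarrow> 'k poly \<times> 'k) set" where
  "ext1_class i j \<xi> = {\<zeta>. cocycle1 i j \<zeta> \<and>
     (\<exists>\<eta>\<in>partV j. \<forall>r<rk1 i. \<zeta> r = \<xi> r + actV \<eta> (d1 i r))}"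

text \<open>
  Representatives of the chosen tangent directions: \<open>x\<close>, \<open>1\<close>, \<open>(1,0)\<close>, \<open>(1,0)\<close>, \<open>(0,1)\<close>.
\<close>

fun tangent :: "gen \<Rightarrow> nat \<Rightarrow> 'k::field poly \<times> 'k" where
  "tangent T11 r = ([:0, 1:], 0)"
| "tangent T12 r = (0, 1)"
| "tangent T21 r = (if r = 0 then (1, 0) else 0)"
| "tangent T22_1 r = (if r = 0 then (0, 1) else 0)"
| "tangent T22_2 r = (if r = 1 then (0, 1) else 0)"

lemma complex_d: "(\<Sum>r<rk1 i. d1 i r * d2 i q r) = (0 :: 'k::field poly poly)"
  by (cases i) (auto simp: numeral_2_eq_2)

lemma tangent_cocycle: "cocycle1 (row a) (col a) (tangent a :: nat \<Rightarrow> 'k::field poly \<times> 'k)"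
  by (cases a) (auto simp: cocycle1_def actV_def numeral_2_eq_2 zero_prod_def)


section \<open>Bimodules and deformations\<close>

text \<open>
  All base rings are of the form \<open>R = S/J\<close>; left \<open>R\<close>-modules are represented as left \<open>S\<close>-modules
  annihilated by \<open>J\<close>.
\<close>

record ('r, 'a, 'm) bimodule = "('r, 'm) module" +
  ract :: "'m \<Rightarrow> 'a \<Rightarrow> 'm" (infixl \<open>\<triangleleft>\<index>\<close> 70)

locale free_bimodule = abelian_group M
  for M :: "('k::field free_alg, 'k poly poly, 'm, 'z) bimodule_scheme" (structure) +
  assumes smult_closed: "m \<in> carrier M \<Longrightarrow> s \<odot> m \<in> carrier M"
    and smult_add_left: "m \<in> carrier M \<Longrightarrow> (s + s') \<odot> m = s \<odot> m \<oplus> s' \<odot> m"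
    and smult_add_right:
      "m \<in> carrier M \<Longrightarrow> m' \<in> carrier M \<Longrightarrow> s \<odot> (m \<oplus> m') = s \<odot> m \<oplus> s \<odot> m'"
    and smult_mult: "m \<in> carrier M \<Longrightarrow> (s * s') \<odot> m = s \<odot> (s' \<odot> m)"
    and smult_one: "m \<in> carrier M \<Longrightarrow> 1 \<odot> m = m"
    and ract_closed: "m \<in> carrier M \<Longrightarrow> m \<triangleleft> a \<in> carrier M"
    and ract_add_right: "m \<in> carrier M \<Longrightarrow> m \<triangleleft> (a + a') = m \<triangleleft> a \<oplus> m \<triangleleft> a'"
    and ract_add_left:
      "m \<in> carrier M \<Longrightarrow> m' \<in> carrier M \<Longrightarrow> (m \<oplus> m') \<triangleleft> a = m \<triangleleft> a \<oplus> m' \<triangleleft> a"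
    and ract_mult: "m \<in> carrier M \<Longrightarrow> m \<triangleleft> (a * a') = (m \<triangleleft> a) \<triangleleft> a'"
    and ract_one: "m \<in> carrier M \<Longrightarrow> m \<triangleleft> 1 = m"
    and smult_ract: "m \<in> carrier M \<Longrightarrow> (s \<odot> m) \<triangleleft> a = s \<odot> (m \<triangleleft> a)"
    and scalar_ract: "m \<in> carrier M \<Longrightarrow> scalar c \<odot> m = m \<triangleleft> [:[:c:]:]"

definition moduleV :: "('k::field free_alg, 'k poly poly, 'k poly \<times> 'k) bimodule" where
  "moduleV = \<lparr>carrier = UNIV, monoid.mult = undefined, one = undefined,
     ring.zero = 0, add = (+),
     module.smult = (\<lambda>s v. ([:word_coeff s (N1, []):] * fst v, word_coeff s (N2, []) * snd v)),
     ract = actV\<rparr>"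

lemma free_bimodule_moduleV: "free_bimodule (moduleV :: ('k::field free_alg, _, _) bimodule)"
proof -
  have A: "abelian_group (moduleV :: ('k free_alg, _, _) bimodule)"
  proof (rule abelian_groupI)
    fix x :: "'k poly \<times> 'k"
    let ?V = "moduleV :: ('k free_alg, _, _) bimodule"
    show "\<exists>y\<in>carrier ?V. y \<oplus>\<^bsub>?V\<^esub> x = \<zero>\<^bsub>?V\<^esub>"
      by (rule bexI[of _ "-x"]) (auto simp: moduleV_def)
  qed (auto simp: moduleV_def add.assoc add.commute)
  show ?thesis
    by (rule free_bimodule.intro[OF A], unfold_locales)
     (auto simp: moduleV_def actV_def algebra_simps plus_free_alg.rep_eq times_free_alg.rep_eq
       one_free_alg.rep_eq scalar.rep_eq smult_add_left smult_add_right)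
qed

text \<open>The subgroup \<open>J M\<close> of \<open>M\<close>.\<close>
definition ideal_act :: "'r set \<Rightarrow> ('r, 'm, 'z) module_scheme \<Rightarrow> 'm set" where
  "ideal_act J M = generate (add_monoid M) {s \<odot>\<^bsub>M\<^esub> m | s m. s \<in> J \<and> m \<in> carrier M}"

text \<open>
  \<open>base_change J M N \<pi>\<close>: the map \<open>\<pi>\<close> is linear on both sides and induces an isomorphism
  \<open>S/J \<otimes>\<^sub>S M = M/JM \<cong> N\<close>.
\<close>
definition base_change :: "'r set \<Rightarrow> ('r, 'a, 'm, 'y) bimodule_scheme \<Rightarrow>
    ('r, 'a, 'n, 'z) bimodule_scheme \<Rightarrow> ('m \<Rightarrow> 'n) \<Rightarrow> bool" where
  "base_change J M N \<pi> \<longleftrightarrow>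
     \<pi> ` carrier M = carrier N \<and>
     (\<forall>m\<in>carrier M. \<forall>m'\<in>carrier M. \<pi> (m \<oplus>\<^bsub>M\<^esub> m') = \<pi> m \<oplus>\<^bsub>N\<^esub> \<pi> m') \<and>
     (\<forall>s. \<forall>m\<in>carrier M. \<pi> (s \<odot>\<^bsub>M\<^esub> m) = s \<odot>\<^bsub>N\<^esub> \<pi> m) \<and>
     (\<forall>a. \<forall>m\<in>carrier M. \<pi> (m \<triangleleft>\<^bsub>M\<^esub> a) = \<pi> m \<triangleleft>\<^bsub>N\<^esub> a) \<and>
     {m \<in> carrier M. \<pi> m = \<zero>\<^bsub>N\<^esub>} = ideal_act J M"

text \<open>
  The left module \<open>R \<otimes>\<^bsub>k\<^sup>2\<^esub> V = R e\<^sub>1 \<otimes>\<^sub>k V\<^sub>1 \<oplus> R e\<^sub>2 \<otimes>\<^sub>k V\<^sub>2\<close> for \<open>R = S/J\<close>: the element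
  \<open>\<Sum>\<^sub>n f n \<otimes> x\<^sup>n + g \<otimes> 1\<close> is represented by the pair \<open>(f, g)\<close>.
\<close>

type_synonym 'k tensor = "(nat \<Rightarrow> 'k free_alg set) \<times> 'k free_alg set"

definition quot_column :: "'k::field free_alg set \<Rightarrow> idx \<Rightarrow> 'k free_alg set set" where
  "quot_column J i = {J +>\<^bsub>free_ring\<^esub> (s * idem i) | s. True}"

definition tensorV :: "'k::field free_alg set \<Rightarrow> ('k free_alg, 'k tensor) module" where
  "tensorV J = (let R = free_ring Quot J in
     \<lparr>carrier = {(f, g). (\<forall>n. f n \<in> quot_column J N1) \<and> finite {n. f n \<noteq> \<zero>\<^bsub>R\<^esub>} \<and>
        g \<in> quot_column J N2},
      monoid.mult = undefined, one = undefined,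
      ring.zero = (\<lambda>n. \<zero>\<^bsub>R\<^esub>, \<zero>\<^bsub>R\<^esub>),
      add = (\<lambda>(f, g) (f', g'). (\<lambda>n. f n \<oplus>\<^bsub>R\<^esub> f' n, g \<oplus>\<^bsub>R\<^esub> g')),
      module.smult = (\<lambda>s (f, g). (\<lambda>n. (J +>\<^bsub>free_ring\<^esub> s) \<otimes>\<^bsub>R\<^esub> f n,
        (J +>\<^bsub>free_ring\<^esub> s) \<otimes>\<^bsub>R\<^esub> g))\<rparr>)"

definition left_isomorphic :: "('r, 'm, 'y) module_scheme \<Rightarrow> ('r, 'n, 'z) module_scheme \<Rightarrow> bool" where
  "left_isomorphic M N \<longleftrightarrow> (\<exists>\<phi>. bij_betw \<phi> (carrier M) (carrier N) \<and>
     (\<forall>m\<in>carrier M. \<forall>m'\<in>carrier M. \<phi> (m \<oplus>\<^bsub>M\<^esub> m') = \<phi> m \<oplus>\<^bsub>N\<^esub> \<phi> m') \<and>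
     (\<forall>s. \<forall>m\<in>carrier M. \<phi> (s \<odot>\<^bsub>M\<^esub> m) = s \<odot>\<^bsub>N\<^esub> \<phi> m))"

text \<open>
  A deformation carries the map to \<open>V\<close> that induces the given isomorphism \<open>k\<^sup>2 \<otimes>\<^sub>R V\<^sub>R \<cong> V\<close>.
  Every deformation to \<open>S/J\<close> is isomorphic, as a left module, to \<open>tensorV J\<close>; hence all equivalence
  classes of deformations already occur on the fixed type \<open>'k tensor\<close>.
\<close>

record (overloaded) 'k deform = "('k free_alg, 'k poly poly, 'k tensor) bimodule" +
  toV :: "'k tensor \<Rightarrow> 'k poly \<times> 'k"

definition deformation :: "'k::field free_alg set \<Rightarrow> 'k deform \<Rightarrow> bool" where
  "deformation J M \<longleftrightarrow> free_bimodule M \<and>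
     (\<forall>s\<in>J. \<forall>m\<in>carrier M. s \<odot>\<^bsub>M\<^esub> m = \<zero>\<^bsub>M\<^esub>) \<and>
     left_isomorphic M (tensorV J) \<and>
     base_change aug M moduleV (toV M)"

text \<open>For \<open>J' \<subseteq> J\<close>: the deformation \<open>M'\<close> to \<open>S/J'\<close> lifts the deformation \<open>M\<close> to \<open>S/J\<close>.\<close>
definition lifts_to ::
    "'k::field free_alg set \<Rightarrow> 'k deform \<Rightarrow> 'k free_alg set \<Rightarrow> 'k deform \<Rightarrow> bool" where
  "lifts_to J M J' M' \<longleftrightarrow> deformation J' M' \<and>
     (\<exists>\<pi>. base_change J M' M \<pi> \<and> (\<forall>m\<in>carrier M'. toV M (\<pi> m) = toV M' m))"

text \<open>
  For an ideal \<open>J'\<close> between \<open>\<mm> J + J \<mm>\<close> and \<open>J\<close>, the image of the obstruction class in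
  \<open>Ext\<^sup>2\<^sub>A(V\<^sub>i, V\<^sub>j) \<otimes> (J/J')\<^sub>i\<^sub>j\<close> vanishes if and only if \<open>M\<close> lifts to \<open>S/J'\<close>.
\<close>
definition obstruction_vanishes ::
    "'k::field free_alg set \<Rightarrow> 'k deform \<Rightarrow> 'k free_alg set \<Rightarrow> bool" where
  "obstruction_vanishes J M J' \<longleftrightarrow> (\<exists>M'. lifts_to J M J' M')"

text \<open>
  A deformation to \<open>S/\<mm>\<^sup>2\<close> has first order part \<open>\<Sum> t\<^sub>i\<^sub>j(l) \<otimes> \<zeta>\<^sub>i\<^sub>j(l)\<close> if it is the cokernel of the
  perturbed differential \<open>d + \<Sum> t\<^sub>i\<^sub>j(l) \<otimes> \<zeta>\<^sub>i\<^sub>j(l)\<close>, that is, if the generators of \<open>V\<^sub>1\<close> and \<open>V\<^sub>2\<close>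
  have lifts \<open>v\<^sub>1\<close> and \<open>v\<^sub>2\<close> satisfying the relations given by the perturbed differential.
  Here \<open>t \<odot> w\<close> only depends on the image of \<open>w\<close> in \<open>V\<close>.
\<close>
definition first_order :: "'k::field deform \<Rightarrow> bool" where
  "first_order M \<longleftrightarrow> (\<exists>v \<zeta> w.
     v N1 \<in> carrier M \<and> idem N1 \<odot>\<^bsub>M\<^esub> v N1 = v N1 \<and> toV M (v N1) = (1, 0) \<and>
     v N2 \<in> carrier M \<and> idem N2 \<odot>\<^bsub>M\<^esub> v N2 = v N2 \<and> toV M (v N2) = (0, 1) \<and>
     (\<forall>a. \<zeta> a \<in> ext1_class (row a) (col a) (tangent a)) \<and>
     (\<forall>a. \<forall>r<rk1 (row a). w a r \<in> carrier M \<and> toV M (w a r) = \<zeta> a r) \<and>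
     (\<forall>i. \<forall>r<rk1 i.
        v i \<triangleleft>\<^bsub>M\<^esub> d1 i r \<oplus>\<^bsub>M\<^esub> (\<Oplus>\<^bsub>M\<^esub>a\<in>{a. row a = i}. tvar a \<odot>\<^bsub>M\<^esub> w a r) = \<zero>\<^bsub>M\<^esub>))"


section \<open>Deforming the line to lines through the origin\<close>

text \<open>
  \<open>k[t\<^sub>1\<^sub>1][x,y]\<close> is the type \<open>'k poly poly poly\<close>, with \<open>t\<^sub>1\<^sub>1\<close> innermost and \<open>y\<close> outermost.
  \<open>to_t11\<close> is the map \<open>S \<rightarrow> k[t\<^sub>1\<^sub>1]\<close> which sets \<open>t\<^sub>1\<^sub>2 = t\<^sub>2\<^sub>1 = 0\<close> and takes the (1,1)-entry.
\<close>

lift_definition to_t11 :: "'k::comm_ring_1 free_alg \<Rightarrow> 'k poly" is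
  "\<lambda>f n. f (N1, replicate n T11)"
proof -
  fix f :: "idx \<times> gen list \<Rightarrow> 'k"
  assume f: "finite {p. f p \<noteq> 0} \<and> (\<forall>i ws. \<not> composable i ws \<longrightarrow> f (i, ws) = 0)"
  have "inj (\<lambda>n. (N1, replicate n T11))"
    by (rule injI) (metis length_replicate snd_conv)
  then have "finite {n. f (N1, replicate n T11) \<noteq> 0}"
    using f finite_vimageI[of "{p. f p \<noteq> 0}" "\<lambda>n. (N1, replicate n T11)"] by (simp add: vimage_def)
  then show "\<forall>\<^sub>\<infinity>n. f (N1, replicate n T11) = 0"
    by (simp add: MOST_iff_cofinite)
qed

definition line_ideal :: "nat \<Rightarrow> 'k::field poly \<Rightarrow> 'k poly poly poly set" where
  "line_ideal n u = Idl\<^bsub>ring_of_type_algebra\<^esub>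
     {[:[:[:0, 1:]:]:] ^ n, [:0, 1:] + [:[:u:]:] * [:[:0, 1:]:]}"

text \<open>The family of lines \<open>(k[t\<^sub>1\<^sub>1]/(t\<^sub>1\<^sub>1\<^sup>n))[x,y]/(y + u x)\<close>, with its bimodule structure.\<close>
definition line_family :: "nat \<Rightarrow> 'k::field poly \<Rightarrow>
    ('k free_alg, 'k poly poly, 'k poly poly poly set) bimodule" where
  "line_family n u = (let B = ring_of_type_algebra; I = line_ideal n u; Q = B Quot I in
     \<lparr>carrier = carrier Q, monoid.mult = monoid.mult Q, one = one Q,
      ring.zero = ring.zero Q, add = add Q,
      module.smult = (\<lambda>s c. (I +>\<^bsub>B\<^esub> [:[:to_t11 s:]:]) \<otimes>\<^bsub>Q\<^esub> c),
      ract = (\<lambda>c a. c \<otimes>\<^bsub>Q\<^esub> (I +>\<^bsub>B\<^esub> map_poly (map_poly (\<lambda>c. [:c:])) a))\<rparr>)"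

text \<open>
  The base change of \<open>M\<close> along \<open>S/J \<rightarrow> k[t\<^sub>1\<^sub>1]/(t\<^sub>1\<^sub>1\<^sup>n)\<close> is a family of lines, as a deformation of
  \<open>V\<^sub>1\<close>: the substitution \<open>t\<^sub>1\<^sub>1 = 0, y = 0\<close> corresponds to the map of \<open>M\<close> to \<open>V\<^sub>1\<close>. The kernel of
  \<open>S/J \<rightarrow> k[t\<^sub>1\<^sub>1]/(t\<^sub>1\<^sub>1\<^sup>n)\<close> is generated by \<open>t\<^sub>1\<^sub>2, t\<^sub>2\<^sub>1\<close> (vanishing off-diagonal part) and \<open>e\<^sub>2\<close>
  (projection to the (1,1)-entry).
\<close>
definition line_condition :: "nat \<Rightarrow> 'k::field free_alg set \<Rightarrow> 'k deform \<Rightarrow> bool" where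
  "line_condition n J M \<longleftrightarrow> (\<exists>u \<theta>.
     base_change (Idl\<^bsub>free_ring\<^esub> (J \<union> {tvar T12, tvar T21, idem N2})) M (line_family n u) \<theta> \<and>
     (\<forall>m\<in>carrier M. \<forall>b\<in>\<theta> m. map_poly (\<lambda>p. poly p 0) (poly b 0) = fst (toV M m)))"


section \<open>The versal base space\<close>

text \<open>
  \<open>Js n\<close> and \<open>Ms n\<close> are the ideal \<open>J\<^sub>n\<close> and the deformation to \<open>H\<^sub>n = S/J\<^sub>n\<close>, for \<open>n \<ge> 2\<close>.
  Ideals of \<open>R\<^bsub>n+1\<^esub>\<close> inside the kernel of \<open>R\<^bsub>n+1\<^esub> \<rightarrow> H\<^sub>n\<close> are represented by their preimages in \<open>S\<close>.
\<close>

definition small_ideals :: "'k::field free_alg set \<Rightarrow> nat \<Rightarrow> 'k free_alg set set" where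
  "small_ideals J n = {I. ideal I free_ring \<and> I \<subseteq> J \<and>
     aug_pow (n + 1) <+>\<^bsub>free_ring\<^esub> (aug \<cdot>\<^bsub>free_ring\<^esub> J) <+>\<^bsub>free_ring\<^esub> (J \<cdot>\<^bsub>free_ring\<^esub> aug) \<subseteq> I}"

definition obstruction_calculus ::
    "(nat \<Rightarrow> 'k::field free_alg set) \<Rightarrow> (nat \<Rightarrow> 'k deform) \<Rightarrow> bool" where
  "obstruction_calculus Js Ms \<longleftrightarrow>
     Js 2 = aug_pow 2 \<and> deformation (Js 2) (Ms 2) \<and> first_order (Ms 2) \<and>
     (\<forall>n\<ge>2.
        Js (n + 1) \<in> small_ideals (Js n) n \<and>
        obstruction_vanishes (Js n) (Ms n) (Js (n + 1)) \<and>
        (\<forall>I \<in> small_ideals (Js n) n. obstruction_vanishes (Js n) (Ms n) I \<longrightarrow> Js (n + 1) \<subseteq> I) \<and>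
        lifts_to (Js n) (Ms n) (Js (n + 1)) (Ms (n + 1)) \<and>
        line_condition n (Js n) (Ms n))"

definition versal_ideal :: "'k::field free_alg set \<Rightarrow> bool" where
  "versal_ideal J \<longleftrightarrow> ideal J free_ring \<and> J \<subseteq> aug_pow 2 \<and>
     (\<exists>Js Ms. obstruction_calculus Js Ms \<and>
        (\<forall>n\<ge>2. J <+>\<^bsub>free_ring\<^esub> aug_pow n = Js n))"

definition versal_base_space :: "'k::field free_alg set ring \<Rightarrow> bool" where
  "versal_base_space H \<longleftrightarrow> (\<exists>J. versal_ideal J \<and> H = free_ring Quot J)"

end

theory Submission
  imports Defs
begin

text \<open>
  \<^bold>\<open>Idea.\<close> The whole tower of the obstruction calculus is read off from one explicit family. Let
  \<open>v\<^sub>1, v\<^sub>2\<close> be generators lifting those of \<open>V\<^sub>1, V\<^sub>2\<close>, and let the right action of \<open>x\<close> and \<open>y\<close> on the free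
  left \<open>S\<close>-module with basis \<open>v\<^sub>1 x\<^sup>n\<close> (\<open>n \<ge> 0\<close>) and \<open>v\<^sub>2\<close> be given by

  \<open>v\<^sub>2 x = - t\<^sub>2\<^sub>1 v\<^sub>1 - t\<^sub>2\<^sub>2(1) v\<^sub>2\<close>, \<open>v\<^sub>1 y = - t\<^sub>1\<^sub>1 v\<^sub>1 x - t\<^sub>1\<^sub>2 v\<^sub>2\<close>, \<open>v\<^sub>2 y = - t\<^sub>2\<^sub>2(2) v\<^sub>2 + t\<^sub>2\<^sub>1 t\<^sub>1\<^sub>1 v\<^sub>1\<close>.

  The linear terms are the chosen tangent directions. The quadratic term \<open>t\<^sub>2\<^sub>1 t\<^sub>1\<^sub>1 v\<^sub>1\<close> is a correction:
  without it the commutator at \<open>v\<^sub>2\<close> would contain \<open>t\<^sub>2\<^sub>1 t\<^sub>1\<^sub>1 v\<^sub>1 x\<close>, whose class in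
  \<open>Ext\<^sup>2\<^sub>A(V\<^sub>2, V\<^sub>1) = V\<^sub>1/xV\<^sub>1\<close> is zero, so that it imposes no relation.
  With it, \<open>x\<close> and \<open>y\<close> commute on every \<open>v\<^sub>1 x\<^sup>n\<close>, and at \<open>v\<^sub>2\<close> the commutator has as coordinates,
  up to sign, exactly the two relations of the proposition (lemma \<open>commutator\<close>). Hence the action
  descends to a flat family over \<open>S/J\<close> for every ideal \<open>J \<subseteq> \<mm>\<close> that contains the relations. If
  \<open>J\<^sub>n\<close> is the ideal generated by the relations and \<open>\<mm>\<^sup>n\<close>, these families lift each other, and
  setting \<open>t\<^sub>1\<^sub>2 = t\<^sub>2\<^sub>1 = 0\<close> leaves the family of lines \<open>y + t\<^sub>1\<^sub>1 x = 0\<close>.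

  It remains to see that \<open>J\<^bsub>n+1\<^esub>\<close> is the smallest admissible ideal (lemma \<open>relations_forced\<close>). Suppose
  that \<open>\<mm>\<^bsup>n+1\<^esup> + \<mm>J\<^sub>n + J\<^sub>n\<mm> \<subseteq> I \<subseteq> J\<^sub>n\<close> and that the family over \<open>S/J\<^sub>n\<close> lifts to a deformation \<open>M\<close> over \<open>S/I\<close>.
  Lifts of \<open>v\<^sub>1, v\<^sub>2\<close> to \<open>M\<close> satisfy the three defining equations up to errors \<open>k\<^sub>1, k\<^sub>2, k\<^sub>3 \<in> J\<^sub>n M\<close>.
  Since \<open>J\<^sub>n M\<close> is annihilated by \<open>\<mm>\<close>, and \<open>j m\<close> for \<open>j \<in> J\<^sub>n\<close> depends only on the image of \<open>m\<close> in \<open>V\<close>,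
  comparing \<open>v\<^sub>2 x y\<close> with \<open>v\<^sub>2 y x\<close> shows that the two relations, applied to the generators, give
  \<open>k\<^sub>1 y - k\<^sub>2 x\<close>. Here \<open>k\<^sub>1 y = 0\<close>, and \<open>k\<^sub>2 x\<close> has only coordinates at \<open>v\<^sub>1 x\<^sup>n\<close> with \<open>n \<ge> 1\<close>, because \<open>y\<close>
  kills \<open>V\<close> and \<open>x\<close> kills \<open>V\<^sub>2\<close>. So the coordinates at \<open>v\<^sub>1\<close> and \<open>v\<^sub>2\<close>, which are the relations,
  vanish modulo \<open>I\<close>, and \<open>J\<^bsub>n+1\<^esub> \<subseteq> I\<close>. The freeness of \<open>M\<close> as a left module enters only through the existence of these
  two coordinates (lemma \<open>coordinate_functional\<close>).
\<close>


section \<open>Two-sided ideals of a ring given by a type\<close>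

lemma type_ring_simps [simp]:
  "carrier ring_of_type_algebra = (UNIV :: 'a::ring_1 set)"
  "x \<otimes>\<^bsub>ring_of_type_algebra\<^esub> y = x * (y :: 'a)"
  "x \<oplus>\<^bsub>ring_of_type_algebra\<^esub> y = x + (y :: 'a)"
  "\<zero>\<^bsub>ring_of_type_algebra\<^esub> = (0 :: 'a)"
  "\<one>\<^bsub>ring_of_type_algebra\<^esub> = (1 :: 'a)"
  by (simp_all add: ring_of_type_algebra_def)

lemma ring_type_ring: "ring (ring_of_type_algebra :: 'a::ring_1 ring)"
proof -
  have "\<exists>y. x + y = 0" for x :: 'a
    using add.right_inverse by blast
  then show ?thesis
    unfolding ring_of_type_algebra_def
    by unfold_locales (auto simp: algebra_simps Units_def)
qed

lemma type_idealI:
  assumes "(0 :: 'a::ring_1) \<in> I" "\<And>x y. x \<in> I \<Longrightarrow> y \<in> I \<Longrightarrow> x + y \<in> I"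
    "\<And>x s. x \<in> I \<Longrightarrow> s * x \<in> I" "\<And>x s. x \<in> I \<Longrightarrow> x * s \<in> I"
  shows "ideal I ring_of_type_algebra"
proof (rule idealI[OF ring_type_ring])
  interpret R: ring "ring_of_type_algebra :: 'a ring" by (rule ring_type_ring)
  show "subgroup I (add_monoid (ring_of_type_algebra :: 'a ring))"
  proof (rule R.add.subgroupI)
    fix a assume a: "a \<in> I"
    have "\<ominus>\<^bsub>ring_of_type_algebra\<^esub> a = - a"
      using R.r_neg[of a] by (simp add: eq_neg_iff_add_eq_0 add.commute)
    then show "\<ominus>\<^bsub>ring_of_type_algebra\<^esub> a \<in> I"
      using assms(3)[OF a, of "-1"] by simp
  qed (use assms in auto)
qed (use assms in auto)

lemma ideal_zero: "ideal I ring_of_type_algebra \<Longrightarrow> (0 :: 'a::ring_1) \<in> I"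
  using additive_subgroup.zero_closed[OF ideal.axioms(1)] by fastforce

lemma ideal_add: "ideal I ring_of_type_algebra \<Longrightarrow> x \<in> I \<Longrightarrow> y \<in> I \<Longrightarrow> x + (y :: 'a::ring_1) \<in> I"
  using additive_subgroup.a_closed[OF ideal.axioms(1)] by fastforce

lemma ideal_lmult: "ideal I ring_of_type_algebra \<Longrightarrow> x \<in> I \<Longrightarrow> s * (x :: 'a::ring_1) \<in> I"
  using ideal.I_l_closed by fastforce

lemma ideal_rmult: "ideal I ring_of_type_algebra \<Longrightarrow> x \<in> I \<Longrightarrow> (x :: 'a::ring_1) * s \<in> I"
  using ideal.I_r_closed by fastforce

lemma ideal_minus: "ideal I ring_of_type_algebra \<Longrightarrow> x \<in> I \<Longrightarrow> - (x :: 'a::ring_1) \<in> I"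
  using ideal_lmult[of I x "-1"] by simp

lemma ideal_minus_iff [simp]:
  "ideal I ring_of_type_algebra \<Longrightarrow> - (x :: 'a::ring_1) \<in> I \<longleftrightarrow> x \<in> I"
  using ideal_minus[of I x] ideal_minus[of I "-x"] by auto

lemma ideal_diff: "ideal I ring_of_type_algebra \<Longrightarrow> x \<in> I \<Longrightarrow> y \<in> I \<Longrightarrow> x - (y :: 'a::ring_1) \<in> I"
  using ideal_add[of I x "-y"] ideal_minus[of I y] by simp

lemma ideal_sum:
  assumes "ideal I ring_of_type_algebra" "\<And>a. a \<in> A \<Longrightarrow> f a \<in> I"
  shows "(\<Sum>a\<in>A. f a :: 'a::ring_1) \<in> I"
  using assms by (induction A rule: infinite_finite_induct) (auto intro: ideal_zero ideal_add)

lemma mem_Idl_gen: "x \<in> B \<Longrightarrow> x \<in> Idl\<^bsub>ring_of_type_algebra\<^esub> (B :: 'a::ring_1 set)"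
  using ring.genideal_self[OF ring_type_ring, of B] by auto

lemma ideal_Idl: "ideal (Idl\<^bsub>ring_of_type_algebra\<^esub> (B :: 'a::ring_1 set)) ring_of_type_algebra"
  by (rule ring.genideal_ideal[OF ring_type_ring]) simp

lemma Idl_minimal:
  "ideal I ring_of_type_algebra \<Longrightarrow> B \<subseteq> I \<Longrightarrow> Idl\<^bsub>ring_of_type_algebra\<^esub> (B :: 'a::ring_1 set) \<subseteq> I"
  by (rule ring.genideal_minimal[OF ring_type_ring])

lemma coset_eq_iff:
  fixes x :: "'a::ring_1"
  assumes "ideal I ring_of_type_algebra"
  shows "I +>\<^bsub>ring_of_type_algebra\<^esub> x = I +>\<^bsub>ring_of_type_algebra\<^esub> y \<longleftrightarrow> x - y \<in> I"
proof
  assume "I +>\<^bsub>ring_of_type_algebra\<^esub> x = I +>\<^bsub>ring_of_type_algebra\<^esub> y"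
  then have "(\<Union>h\<in>I. {h + x}) = (\<Union>h\<in>I. {h + y})" by (simp add: a_r_coset_def')
  moreover have "x \<in> (\<Union>h\<in>I. {h + x})" using ideal_zero[OF assms] by force
  ultimately obtain h where "h \<in> I" "x = h + y" by auto
  then show "x - y \<in> I" by simp
next
  assume d: "x - y \<in> I"
  have "(\<Union>h\<in>I. {h + x}) = (\<Union>h\<in>I. {h + y})"
  proof (intro equalityI subsetI)
    fix z assume "z \<in> (\<Union>h\<in>I. {h + x})"
    then obtain h where "h \<in> I" "z = h + x" by auto
    then show "z \<in> (\<Union>h\<in>I. {h + y})"
      using ideal_add[OF assms _ d, of h] by (auto intro!: bexI[of _ "h + (x - y)"])
  next
    fix z assume "z \<in> (\<Union>h\<in>I. {h + y})"
    then obtain h where "h \<in> I" "z = h + y" by auto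
    then show "z \<in> (\<Union>h\<in>I. {h + x})"
      using ideal_diff[OF assms _ d, of h] by (auto intro!: bexI[of _ "h - (x - y)"])
  qed
  then show "I +>\<^bsub>ring_of_type_algebra\<^esub> x = I +>\<^bsub>ring_of_type_algebra\<^esub> y"
    by (simp add: a_r_coset_def')
qed

lemma mem_coset_iff:
  "z \<in> I +>\<^bsub>ring_of_type_algebra\<^esub> (x :: 'a::ring_1) \<longleftrightarrow> z - x \<in> I"
  by (auto simp: a_r_coset_def' intro!: bexI[of _ "z - x"])

lemma quot_simps:
  fixes I :: "'a::ring_1 set"
  assumes "ideal I ring_of_type_algebra"
  shows "(I +>\<^bsub>ring_of_type_algebra\<^esub> x) \<oplus>\<^bsub>ring_of_type_algebra Quot I\<^esub> (I +>\<^bsub>ring_of_type_algebra\<^esub> y)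
      = I +>\<^bsub>ring_of_type_algebra\<^esub> (x + y)"
    and "(I +>\<^bsub>ring_of_type_algebra\<^esub> x) \<otimes>\<^bsub>ring_of_type_algebra Quot I\<^esub> (I +>\<^bsub>ring_of_type_algebra\<^esub> y)
      = I +>\<^bsub>ring_of_type_algebra\<^esub> (x * y)"
    and "\<zero>\<^bsub>ring_of_type_algebra Quot I\<^esub> = I +>\<^bsub>ring_of_type_algebra\<^esub> 0"
    and "carrier (ring_of_type_algebra Quot I) = range (\<lambda>x. I +>\<^bsub>ring_of_type_algebra\<^esub> x)"
proof -
  let ?R = "ring_of_type_algebra :: 'a ring"
  have h: "(+>\<^bsub>?R\<^esub>) I \<in> ring_hom ?R (?R Quot I)"
    by (rule ideal.rcos_ring_hom[OF assms])
  show "(I +>\<^bsub>?R\<^esub> x) \<oplus>\<^bsub>?R Quot I\<^esub> (I +>\<^bsub>?R\<^esub> y) = I +>\<^bsub>?R\<^esub> (x + y)"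
    using ring_hom_add[OF h, of x y] by simp
  show "(I +>\<^bsub>?R\<^esub> x) \<otimes>\<^bsub>?R Quot I\<^esub> (I +>\<^bsub>?R\<^esub> y) = I +>\<^bsub>?R\<^esub> (x * y)"
    using ring_hom_mult[OF h, of x y] by simp
  show "\<zero>\<^bsub>?R Quot I\<^esub> = I +>\<^bsub>?R\<^esub> 0"
    by (simp add: FactRing_def a_r_coset_def')
  show "carrier (?R Quot I) = range (\<lambda>x. I +>\<^bsub>?R\<^esub> x)"
    by (auto simp: FactRing_def A_RCOSETS_def')
qed

lemma mem_set_add_iff:
  "x \<in> I <+>\<^bsub>ring_of_type_algebra\<^esub> J \<longleftrightarrow> (\<exists>a\<in>I. \<exists>b\<in>J. x = a + (b :: 'a::ring_1))"
  by (auto simp: set_add_def')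

lemma ideal_set_add:
  "ideal I ring_of_type_algebra \<Longrightarrow> ideal J ring_of_type_algebra
    \<Longrightarrow> ideal (I <+>\<^bsub>ring_of_type_algebra\<^esub> (J :: 'a::ring_1 set)) ring_of_type_algebra"
  by (rule ring.add_ideals[OF ring_type_ring])

lemma ideal_prod_ideal:
  "ideal I ring_of_type_algebra \<Longrightarrow> ideal J ring_of_type_algebra
    \<Longrightarrow> ideal (I \<cdot>\<^bsub>ring_of_type_algebra\<^esub> (J :: 'a::ring_1 set)) ring_of_type_algebra"
  by (rule ring.ideal_prod_is_ideal[OF ring_type_ring])

lemma ideal_prod_mem:
  "x \<in> I \<Longrightarrow> y \<in> J \<Longrightarrow> x * (y :: 'a::ring_1) \<in> I \<cdot>\<^bsub>ring_of_type_algebra\<^esub> J"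
  using ideal_prod.prod[of x I y J ring_of_type_algebra] by simp

lemma ideal_prod_subset:
  fixes I J L :: "'a::ring_1 set"
  assumes "ideal L ring_of_type_algebra" "\<And>x y. x \<in> I \<Longrightarrow> y \<in> J \<Longrightarrow> x * y \<in> L"
  shows "I \<cdot>\<^bsub>ring_of_type_algebra\<^esub> J \<subseteq> L"
proof
  fix x assume "x \<in> I \<cdot>\<^bsub>ring_of_type_algebra\<^esub> J"
  then show "x \<in> L"
    by induction (use assms in \<open>auto intro: ideal_add\<close>)
qed

section \<open>Words and the $\mathfrak m$-adic filtration\<close>

lemma aug_gen: "tvar a \<in> aug"
  by (auto simp: aug_def intro: mem_Idl_gen)

lemma ideal_aug: "ideal aug (free_ring :: 'k::comm_ring_1 free_alg ring)"
  unfolding aug_def by (rule ideal_Idl)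

lemma ideal_aug_pow: "ideal (aug_pow n) (free_ring :: 'k::comm_ring_1 free_alg ring)"
proof (induction n)
  case 0
  then show ?case by (auto intro: type_idealI)
qed (auto intro: ideal_prod_ideal ideal_aug)

lemma free_alg_eqI: "(\<And>i ws. word_coeff x (i, ws) = word_coeff y (i, ws)) \<Longrightarrow> x = y"
  by (auto simp flip: word_coeff_inject)

lemma word_coeff_simps [simp]:
  "word_coeff 0 p = 0"
  "word_coeff (x + y) p = word_coeff x p + word_coeff y p"
  "word_coeff (x - y) p = word_coeff x p - word_coeff y p"
  "word_coeff (- x) p = - word_coeff x p"
  by (simp_all add: zero_free_alg.rep_eq plus_free_alg.rep_eq minus_free_alg.rep_eq
      uminus_free_alg.rep_eq)

lemma word_coeff_sum: "word_coeff (\<Sum>a\<in>A. f a) p = (\<Sum>a\<in>A. word_coeff (f a) p)"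
  by (induction A rule: infinite_finite_induct) auto

lemma word_coeff_times:
  "word_coeff (x * y) (i, ws) = (\<Sum>l\<le>length ws. word_coeff x (i, take l ws)
      * word_coeff y (last_idx i (take l ws), drop l ws))"
  by (simp add: times_free_alg.rep_eq)

lemma word_coeff_times_Nil [simp]: "word_coeff (x * y) (i, []) = word_coeff x (i, []) * word_coeff y (i, [])"
  by (simp add: word_coeff_times)

lemma word_coeff_idem_times [simp]:
  "word_coeff (idem j * x) (i, ws) = (if i = j then word_coeff x (i, ws) else 0)"
proof -
  have "word_coeff (idem j * x) (i, ws)
      = (\<Sum>l\<le>length ws. if l = 0 then if i = j then word_coeff x (i, ws) else 0 else 0)"
    unfolding word_coeff_times by (intro sum.cong refl) (auto simp: idem.rep_eq)
  then show ?thesis by (simp cong: if_cong)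
qed

lemma word_coeff_scalar_times [simp]:
  "word_coeff (scalar c * x) (i, ws) = c * word_coeff x (i, ws)"
proof -
  have "word_coeff (scalar c * x) (i, ws)
      = (\<Sum>l\<le>length ws. if l = 0 then c * word_coeff x (i, ws) else 0)"
    unfolding word_coeff_times by (intro sum.cong refl) (auto simp: scalar.rep_eq)
  then show ?thesis by (simp cong: if_cong)
qed

lemma word_coeff_tvar_times [simp]:
  "word_coeff (tvar a * x) (i, []) = 0"
  "word_coeff (tvar a * x) (i, b # ws) = (if i = row a \<and> a = b then word_coeff x (col a, ws) else 0)"
proof -
  show "word_coeff (tvar a * x) (i, []) = 0" by (simp add: tvar.rep_eq)
  have "word_coeff (tvar a * x) (i, b # ws)
      = (\<Sum>l\<le>Suc (length ws). if l = 1 then if i = row a \<and> a = b then word_coeff x (col a, ws) else 0 else 0)"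
    unfolding word_coeff_times list.size
    by (intro sum.cong) (auto simp: tvar.rep_eq take_Cons' drop_Cons')
  then show "word_coeff (tvar a * x) (i, b # ws)
      = (if i = row a \<and> a = b then word_coeff x (col a, ws) else 0)" by (cases ws) (auto simp: Suc_le_eq)
qed

lemma word_coeff_one: "word_coeff 1 (i, ws) = (if ws = [] then 1 else 0)"
  by (simp add: one_free_alg.rep_eq)

lemma scalar_central: "scalar c * x = x * scalar c"
proof (rule free_alg_eqI)
  fix i ws
  have "word_coeff (x * scalar c) (i, ws)
      = (\<Sum>l\<le>length ws. if l = length ws then c * word_coeff x (i, ws) else 0)"
    unfolding word_coeff_times by (intro sum.cong refl) (auto simp: scalar.rep_eq)
  then show "word_coeff (scalar c * x) (i, ws) = word_coeff (x * scalar c) (i, ws)" by simp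
qed

lemma scalar_simps:
  "scalar 0 = 0" "scalar 1 = 1" "scalar (a + b) = scalar a + scalar b"
  "scalar (a * b) = scalar a * scalar b"
  by (auto intro!: free_alg_eqI simp: scalar.rep_eq word_coeff_one)

lemma idem_idem [simp]: "idem i * idem j = (if i = j then idem i else 0)"
  by (auto intro!: free_alg_eqI simp: idem.rep_eq)

lemma tvar_col [simp]: "tvar a * idem j = (if j = col a then tvar a else 0)"
proof -
  have "tvar a * idem j = tvar a * (idem (col a) * idem j)"
    unfolding mult.assoc[symmetric] by (simp add: tvar_corners)
  then show ?thesis by (auto simp: tvar_corners)
qed

lemma tvar_row [simp]: "idem j * tvar a = (if j = row a then tvar a else 0)"
proof -
  have "idem j * tvar a = idem j * idem (row a) * tvar a"
    unfolding mult.assoc by (simp add: tvar_corners)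
  then show ?thesis by (auto simp: tvar_corners)
qed

lemma tvar_col_assoc [simp]: "x * tvar a * idem j = (if j = col a then x * tvar a else 0)"
  by (simp add: mult.assoc)

lemma tvar_row_assoc [simp]: "x * idem j * tvar a = (if j = row a then x * tvar a else 0)"
  by (simp add: mult.assoc)

lift_definition word :: "idx \<Rightarrow> gen list \<Rightarrow> 'k::comm_ring_1 free_alg" is
  "\<lambda>i ws p. if p = (i, ws) \<and> composable i ws then 1 else 0"
  by auto

lemma word_Nil: "word i [] = idem i"
  by (auto intro!: free_alg_eqI simp: word.rep_eq idem.rep_eq)

lemma word_Cons: "word i (a # ws) = (if i = row a then tvar a * word (col a) ws else 0)"
proof (rule free_alg_eqI)
  fix j vs
  show "word_coeff (word i (a # ws)) (j, vs)
      = (word_coeff (if i = row a then tvar a * word (col a) ws else 0) (j, vs) :: 'a)"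
    by (cases vs) (auto simp: word.rep_eq tvar.rep_eq)
qed

lemma sum_of_words:
  "x = (\<Sum>(i, ws)\<in>{p. word_coeff x p \<noteq> 0}. scalar (word_coeff x (i, ws)) * word i ws)"
    (is "x = ?y")
proof (rule free_alg_eqI)
  fix i ws
  have fin: "finite {p. word_coeff x p \<noteq> 0}" using word_coeff[of x] by simp
  have "word_coeff ?y (i, ws) = (\<Sum>p\<in>{p. word_coeff x p \<noteq> 0}. if p = (i, ws) then word_coeff x (i, ws) else 0)"
    unfolding word_coeff_sum
  proof (intro sum.cong refl, clarify)
    fix j vs assume "word_coeff x (j, vs) \<noteq> 0"
    then have "composable j vs" using word_coeff[of x] by blast
    then show "word_coeff (scalar (word_coeff x (j, vs)) * word j vs) (i, ws)
        = (if (j, vs) = (i, ws) then word_coeff x (i, ws) else 0)"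
      by (auto simp: word.rep_eq)
  qed
  then show "word_coeff x (i, ws) = word_coeff ?y (i, ws)"
    using fin by simp
qed

text \<open>
  The composable words form a \<open>k\<close>-basis, so an ideal contains \<open>x\<close> as soon as it contains the words
  that occur in \<open>x\<close>. This turns conditions on coefficients into membership in an ideal.
\<close>
lemma ideal_if_words:
  fixes x :: "'k::comm_ring_1 free_alg"
  assumes "ideal I free_ring" "\<And>i ws. word_coeff x (i, ws) \<noteq> 0 \<Longrightarrow> word i ws \<in> I"
  shows "x \<in> I"
proof -
  have "(\<Sum>(i, ws)\<in>{p. word_coeff x p \<noteq> 0}. scalar (word_coeff x (i, ws)) * word i ws) \<in> I"
    by (rule ideal_sum[OF assms(1)]) (auto intro: ideal_lmult[OF assms(1)] assms(2))
  then show ?thesis by (simp flip: sum_of_words)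
qed

definition order_ge :: "nat \<Rightarrow> 'k::comm_ring_1 free_alg set" where
  "order_ge n = {x. \<forall>i ws. length ws < n \<longrightarrow> word_coeff x (i, ws) = 0}"

lemma order_ge_mult:
  assumes "x \<in> order_ge m" "y \<in> order_ge n"
  shows "x * y \<in> order_ge (m + n)"
  unfolding order_ge_def
proof (intro CollectI allI impI)
  fix i ws assume len: "length (ws :: gen list) < m + n"
  have "word_coeff x (i, take l ws) * word_coeff y (last_idx i (take l ws), drop l ws) = 0"
    if l: "l \<le> length ws" for l
  proof (cases "l < m")
    case True
    with l assms(1) have "word_coeff x (i, take l ws) = 0" by (auto simp: order_ge_def)
    then show ?thesis by simp
  next
    case False
    with l len have "length (drop l ws) < n" by simp
    with assms(2) have "word_coeff y (last_idx i (take l ws), drop l ws) = 0"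
      unfolding order_ge_def by blast
    then show ?thesis by simp
  qed
  then show "word_coeff (x * y) (i, ws) = 0" by (simp add: word_coeff_times)
qed

lemma ideal_order_ge: "ideal (order_ge n) (free_ring :: 'k::comm_ring_1 free_alg ring)"
proof (rule type_idealI)
  fix x s :: "'k free_alg" assume x: "x \<in> order_ge n"
  have s: "s \<in> order_ge 0" by (simp add: order_ge_def)
  show "s * x \<in> order_ge n" using order_ge_mult[OF s x] by simp
  show "x * s \<in> order_ge n" using order_ge_mult[OF x s] by simp
qed (auto simp: order_ge_def)

lemma aug_eq_order_ge: "aug = (order_ge 1 :: 'k::comm_ring_1 free_alg set)"
proof
  show "aug \<subseteq> (order_ge 1 :: 'k free_alg set)"
    unfolding aug_def by (rule Idl_minimal[OF ideal_order_ge]) (auto simp: order_ge_def tvar.rep_eq)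
  show "order_ge 1 \<subseteq> (aug :: 'k free_alg set)"
  proof
    fix x :: "'k free_alg" assume x: "x \<in> order_ge 1"
    show "x \<in> aug"
    proof (rule ideal_if_words[OF ideal_aug])
      fix i ws assume "word_coeff x (i, ws) \<noteq> 0"
      with x obtain a vs where "ws = a # vs" by (cases ws) (auto simp: order_ge_def)
      then show "word i ws \<in> aug"
        by (auto simp: word_Cons intro: ideal_rmult[OF ideal_aug aug_gen] ideal_zero ideal_aug)
    qed
  qed
qed

text \<open>
  The filtration by powers of \<open>\<mm>\<close> is the word length filtration, so membership in \<open>\<mm>\<^sup>n\<close> is
  read off from coefficients and \<open>\<mm>\<^sup>n \<mm> \<subseteq> \<mm>\<^bsup>n+1\<^esup>\<close> is immediate.
\<close>
lemma aug_pow_eq_order_ge: "aug_pow n = (order_ge n :: 'k::comm_ring_1 free_alg set)"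
proof (induction n)
  case 0
  then show ?case by (simp add: order_ge_def)
next
  case (Suc n)
  show ?case
  proof
    show "aug_pow (Suc n) \<subseteq> (order_ge (Suc n) :: 'k free_alg set)"
      unfolding aug_pow.simps Suc aug_eq_order_ge
      by (rule ideal_prod_subset[OF ideal_order_ge]) (use order_ge_mult[of _ 1] in fastforce)
    show "order_ge (Suc n) \<subseteq> (aug_pow (Suc n) :: 'k free_alg set)"
    proof
      fix x :: "'k free_alg" assume x: "x \<in> order_ge (Suc n)"
      show "x \<in> aug_pow (Suc n)"
      proof (rule ideal_if_words[OF ideal_aug_pow])
        fix i ws assume "word_coeff x (i, ws) \<noteq> 0"
        with x have len: "length ws \<ge> Suc n" by (force simp: order_ge_def not_less)
        then obtain a vs where ws: "ws = a # vs" by (cases ws) auto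
        have "word (col a) vs \<in> (order_ge n :: 'k free_alg set)"
          using len by (auto simp: order_ge_def word.rep_eq ws)
        then have "tvar a * word (col a) vs \<in> (aug_pow (Suc n) :: 'k free_alg set)"
          unfolding aug_pow.simps Suc by (rule ideal_prod_mem[OF aug_gen])
        then show "word i ws \<in> (aug_pow (Suc n) :: 'k free_alg set)"
          unfolding ws word_Cons using ideal_zero[OF ideal_aug_pow[of "Suc n", where ?'k = 'k]] by (simp del: aug_pow.simps)
      qed
    qed
  qed
qed

lemma aug_iff: "x \<in> aug \<longleftrightarrow> (\<forall>i. word_coeff x (i, []) = 0)"
  by (auto simp: aug_eq_order_ge order_ge_def)

lemma aug_pow_mult_aug: "x \<in> aug_pow n \<Longrightarrow> y \<in> aug \<Longrightarrow> x * y \<in> aug_pow (n + 1)"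
  using order_ge_mult[of x n y 1] by (simp add: aug_pow_eq_order_ge aug_eq_order_ge del: aug_pow.simps)


section \<open>Horner evaluation in a module\<close>

text \<open>
  \<open>horner f F p\<close> is \<open>\<Sum>\<^sub>n F\<^sup>n (f p\<^sub>n)\<close>. It serves three purposes: to extend an operator from the generator
  \<open>v\<^sub>1\<close> to all \<open>v\<^sub>1 x\<^sup>n\<close> (with \<open>F\<close> the operator \<open>x\<close>), and to let polynomials in \<open>x\<close>, and polynomials in \<open>y\<close>
  with coefficients in \<open>k[x]\<close>, act through the operators.
\<close>
definition horner :: "('c::zero \<Rightarrow> 'm) \<Rightarrow> ('m \<Rightarrow> 'm) \<Rightarrow> 'c poly \<Rightarrow> 'm::ab_group_add" where
  "horner f F p = fold_coeffs (\<lambda>c r. f c + F r) p 0"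

lemma additive_zero:
  fixes F :: "'a::ab_group_add \<Rightarrow> 'b::ab_group_add"
  assumes "\<And>a b. F (a + b) = F a + F b"
  shows "F 0 = 0"
  using assms[of 0 0] by simp

lemma additive_minus:
  fixes F :: "'a::ab_group_add \<Rightarrow> 'b::ab_group_add"
  assumes "\<And>a b. F (a + b) = F a + F b"
  shows "F (- a) = - F a"
  using assms[of a "-a"] additive_zero[OF assms] by (simp add: eq_neg_iff_add_eq_0 add.commute)

lemma horner_0 [simp]: "horner f F 0 = 0"
  by (simp add: horner_def)

lemma horner_pCons:
  assumes "f 0 = 0" "F 0 = 0"
  shows "horner f F (pCons c p) = f c + F (horner f F p)"
  using assms by (cases "c = 0 \<and> p = 0") (auto simp: horner_def)

lemma horner_add:
  assumes f: "\<And>a b. f (a + b) = f a + f b" and F: "\<And>a b. F (a + b) = F a + F b"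
  shows "horner f F (p + q) = horner f F p + horner f F (q :: 'c::ab_group_add poly)"
proof (induction p arbitrary: q)
  case 0
  then show ?case by simp
next
  case (pCons c p)
  note step = horner_pCons[of f F, OF additive_zero[of f, OF f] additive_zero[of F, OF F]]
  obtain d q' where q: "q = pCons d q'" by (cases q)
  show ?case by (simp add: q step pCons.IH f F)
qed

lemma horner_mem:
  assumes "\<And>n. f (coeff p n) \<in> K" "\<And>m. m \<in> K \<Longrightarrow> F m \<in> K" "0 \<in> K"
    "\<And>a b. a \<in> K \<Longrightarrow> b \<in> K \<Longrightarrow> a + b \<in> K" "f 0 = 0" "F 0 = 0"
  shows "horner f F p \<in> K"
  using assms(1)
proof (induction p)
  case (pCons c p)
  have "f c \<in> K" using pCons.prems[of 0] by simp
  moreover have "horner f F p \<in> K"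
    by (rule pCons.IH) (use pCons.prems[of "Suc _"] in simp)
  ultimately show ?case by (simp add: horner_pCons assms)
qed (simp add: assms)


section \<open>The operators $x$ and $y$ on the free module\<close>

text \<open>
  The pair \<open>(p, g)\<close> stands for \<open>\<Sum>\<^sub>n p\<^sub>n v\<^sub>1 x\<^sup>n + g v\<^sub>2\<close>. The coefficients range over all of \<open>S\<close>; only
  \<open>p\<^sub>n e\<^sub>1\<close> and \<open>g e\<^sub>2\<close> survive the passage to \<open>S/J \<otimes>\<^bsub>k\<^sup>2\<^esub> V\<close>. Working with representatives keeps the
  computations in a type of class \<open>ab_group_add\<close>.
\<close>
type_synonym 'k rep = "'k free_alg poly \<times> 'k free_alg"

definition lsmult :: "'k::field free_alg \<Rightarrow> 'k rep \<Rightarrow> 'k rep" (infixr \<open>\<bullet>\<close> 75) where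
  "s \<bullet> m = (map_poly ((*) s) (fst m), s * snd m)"

text \<open>
  Right multiplication by \<open>x\<close> shifts \<open>v\<^sub>1 x\<^sup>n\<close> and sends \<open>v\<^sub>2\<close> to \<open>- t\<^sub>2\<^sub>1 v\<^sub>1 - t\<^sub>2\<^sub>2(1) v\<^sub>2\<close>. Right multiplication
  by \<open>y\<close> sends \<open>v\<^sub>1\<close> to \<open>y1\<close> and \<open>v\<^sub>2\<close> to \<open>y2\<close>, and \<open>v\<^sub>1 x\<^sup>n\<close> to \<open>y1 x\<^sup>n\<close>, so that the two operators commute on
  the span of the \<open>v\<^sub>1 x\<^sup>n\<close> by construction.
\<close>
definition opx :: "'k::field rep \<Rightarrow> 'k rep" where
  "opx m = (pCons (- snd m * tvar T21) (fst m), - snd m * tvar T22_1)"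

definition y1 :: "'k::field rep" where "y1 = ([:0, - tvar T11:], - tvar T12)"
definition y2 :: "'k::field rep" where "y2 = ([:tvar T21 * tvar T11:], - tvar T22_2)"

definition opy :: "'k::field rep \<Rightarrow> 'k rep" where
  "opy m = horner (\<lambda>c. c \<bullet> y1) opx (fst m) + snd m \<bullet> y2"

text \<open>
  The operators commute only modulo the relations, so the action of a polynomial fixes an order:
  a monomial \<open>x\<^sup>i y\<^sup>j\<close> applies \<open>x\<close> first.
\<close>
definition act_x :: "'k::field poly \<Rightarrow> 'k rep \<Rightarrow> 'k rep" where
  "act_x p m = horner (\<lambda>c. scalar c \<bullet> m) opx p"

definition act :: "'k::field poly poly \<Rightarrow> 'k rep \<Rightarrow> 'k rep" where
  "act a m = horner (\<lambda>p. act_x p m) opy a"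

lemma lsmult_simps:
  "(s + t) \<bullet> m = s \<bullet> m + t \<bullet> m" "s \<bullet> (m + m') = s \<bullet> m + s \<bullet> m'"
  "(s * t) \<bullet> m = s \<bullet> t \<bullet> m" "1 \<bullet> m = m" "0 \<bullet> m = 0" "s \<bullet> 0 = 0"
  by (auto simp: lsmult_def prod_eq_iff poly_eq_iff coeff_map_poly distrib_left distrib_right mult.assoc)

lemma scalar_lsmult_commute: "s \<bullet> scalar c \<bullet> m = scalar c \<bullet> s \<bullet> m"
  by (simp add: scalar_central flip: lsmult_simps(3))

lemma opx_add: "opx (m + m') = opx m + opx m'"
  by (simp add: opx_def algebra_simps)

lemma opx_0 [simp]: "opx 0 = 0"
  by (rule additive_zero[OF opx_add])

lemma opx_lsmult: "opx (s \<bullet> m) = s \<bullet> opx m"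
  by (simp add: opx_def lsmult_def map_poly_pCons mult.assoc)

lemma opy_add: "opy (m + m') = opy m + opy m'"
  by (simp add: opy_def lsmult_simps opx_add horner_add[of "\<lambda>c. c \<bullet> y1" opx])

lemma opy_0 [simp]: "opy 0 = 0"
  by (rule additive_zero[OF opy_add])

lemma horner_map_poly_lsmult:
  "horner (\<lambda>c. c \<bullet> m) opx (map_poly ((*) s) p) = s \<bullet> horner (\<lambda>c. c \<bullet> m) opx p"
proof (induction p)
  case (pCons c p)
  have "map_poly ((*) s) (pCons c p) = pCons (s * c) (map_poly ((*) s) p)"
    by (simp add: map_poly_pCons)
  then show ?case
    by (simp add: horner_pCons lsmult_simps pCons.IH opx_lsmult)
qed (simp add: lsmult_simps)

lemma opy_lsmult: "opy (s \<bullet> m) = s \<bullet> opy m"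
  by (simp add: opy_def lsmult_simps horner_map_poly_lsmult lsmult_def[of s m])

lemma opy_opx_poly: "opy (opx (p, 0)) = opx (opy (p, 0))"
  by (simp add: opy_def opx_def[of "(p, 0)"] lsmult_simps horner_pCons)

text \<open>
  The obstructions in \<open>Ext\<^sup>2\<^sub>A(V\<^sub>2, V\<^sub>2)\<close> and in \<open>Ext\<^sup>2\<^sub>A(V\<^sub>2, V\<^sub>1)\<close>; both spaces are one-dimensional and
  \<open>Ext\<^sup>2\<^sub>A(V\<^sub>1, -) = 0\<close>, so there is one relation for each.
\<close>
definition rel_point :: "'k::comm_ring_1 free_alg" where
  "rel_point = tvar T22_2 * tvar T22_1 - tvar T22_1 * tvar T22_2 - tvar T21 * tvar T12"

definition rel_line :: "'k::comm_ring_1 free_alg" where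
  "rel_line = tvar T22_2 * tvar T21 + tvar T22_1 * tvar T21 * tvar T11"

text \<open>
  Only \<open>v\<^sub>2\<close> contributes. The coefficient of \<open>v\<^sub>1 x\<close> is \<open>t\<^sub>2\<^sub>1 t\<^sub>1\<^sub>1\<close> in both \<open>v\<^sub>2 x y\<close> and \<open>v\<^sub>2 y x\<close>: in the first
  it comes from \<open>v\<^sub>1 y\<close>, in the second from the correction term of \<open>y2\<close>.
\<close>
lemma commutator: "opy (opx m) - opx (opy m) = - (snd m \<bullet> ([:rel_line:], rel_point))"
proof -
  obtain p g where m: "m = (p, g)" by fastforce
  have split: "m = (p, 0) + (0, g)" by (simp add: m)
  have 1: "opy (opx (0, g)) = (- g * tvar T21) \<bullet> y1 + (- g * tvar T22_1) \<bullet> y2"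
    by (simp add: opy_def opx_def[of "(0, g)"] horner_pCons lsmult_simps)
  have 2: "opy (0, g) = g \<bullet> y2"
    by (simp add: opy_def)
  show ?thesis
    unfolding split opx_add opy_add opy_opx_poly 1 2
    by (simp add: opx_def lsmult_def y1_def y2_def map_poly_pCons rel_line_def rel_point_def
        algebra_simps)
qed

lemma act_x_pCons: "act_x (pCons c p) m = scalar c \<bullet> m + opx (act_x p m)"
  by (simp add: act_x_def horner_pCons scalar_simps lsmult_simps)

lemma act_x_0 [simp]: "act_x 0 m = 0"
  by (simp add: act_x_def)

lemma act_pCons: "act (pCons p a) m = act_x p m + opy (act a m)"
  by (simp add: act_def horner_pCons)

lemma act_0 [simp]: "act 0 m = 0"
  by (simp add: act_def)

lemma act_x_add_poly: "act_x (p + q) m = act_x p m + act_x q m"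
  unfolding act_x_def by (rule horner_add) (auto simp: scalar_simps lsmult_simps opx_add)

lemma act_add_poly: "act (a + b) m = act a m + act b m"
  unfolding act_def by (rule horner_add) (auto simp: act_x_add_poly opy_add)

lemma act_x_add: "act_x p (m + m') = act_x p m + act_x p m'"
  by (induction p) (auto simp: act_x_pCons lsmult_simps opx_add)

lemma act_add: "act a (m + m') = act a m + act a m'"
  by (induction a) (auto simp: act_pCons act_x_add opy_add)

lemma act_0_right [simp]: "act a 0 = 0"
  by (rule additive_zero[OF act_add])

lemma act_x_lsmult: "act_x p (s \<bullet> m) = s \<bullet> act_x p m"
  by (induction p) (auto simp: act_x_pCons lsmult_simps opx_lsmult scalar_lsmult_commute)

lemma act_lsmult: "act a (s \<bullet> m) = s \<bullet> act a m"
  by (induction a) (auto simp: act_pCons act_x_lsmult lsmult_simps opy_lsmult)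

lemma act_x_smult: "act_x (Polynomial.smult c p) m = scalar c \<bullet> act_x p m"
  by (induction p) (auto simp: act_x_pCons lsmult_simps scalar_simps opx_lsmult)

lemma act_x_mult: "act_x (p * q) m = act_x q (act_x p m)"
  unfolding mult.commute[of p q]
  by (induction q) (auto simp: act_x_pCons act_x_add_poly act_x_smult scalar_simps lsmult_simps)

lemma act_smult: "act (Polynomial.smult p a) m = act a (act_x p m)"
  by (induction a) (auto simp: act_pCons act_x_mult)

lemma act_const: "act [:[:c:]:] m = scalar c \<bullet> m"
  by (simp add: act_pCons act_x_pCons)

lemma act_one: "act 1 m = m"
  using act_const[of 1 m] by (simp add: one_pCons scalar_simps lsmult_simps)

lemma act_xA: "act [:[:0, 1:]:] m = opx m"
  by (simp add: act_pCons act_x_pCons scalar_simps lsmult_simps)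

lemma act_yA: "act [:0, 1:] m = opy m"
  by (simp add: act_pCons act_x_pCons scalar_simps lsmult_simps one_pCons)

text \<open>
  The submodule \<open>L v\<^sub>1 x\<^sup>n + \<dots> + L v\<^sub>2\<close>, together with the coefficients in the wrong column: the kernel of the
  map to \<open>S/L \<otimes>\<^bsub>k\<^sup>2\<^esub> V\<close>.
\<close>
definition subrep :: "'k::field free_alg set \<Rightarrow> 'k rep set" where
  "subrep L = {m. (\<forall>n. coeff (fst m) n * idem N1 \<in> L) \<and> snd m * idem N2 \<in> L}"

locale two_sided_ideal =
  fixes L :: "'k::field free_alg set"
  assumes ideal_L: "ideal L free_ring"
begin

lemma subrep_add: "m \<in> subrep L \<Longrightarrow> m' \<in> subrep L \<Longrightarrow> m + m' \<in> subrep L"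
  by (auto simp: subrep_def distrib_right intro: ideal_add[OF ideal_L])

lemma subrep_0 [simp]: "0 \<in> subrep L"
  by (auto simp: subrep_def ideal_zero[OF ideal_L])

lemma subrep_minus [simp]: "- m \<in> subrep L \<longleftrightarrow> m \<in> subrep L"
  by (auto simp: subrep_def ideal_L)

lemma subrep_lsmult: "m \<in> subrep L \<Longrightarrow> s \<bullet> m \<in> subrep L"
  by (auto simp: subrep_def lsmult_def coeff_map_poly mult.assoc intro: ideal_lmult[OF ideal_L])

lemma lsmult_mem_subrep: "s \<in> L \<Longrightarrow> s \<bullet> m \<in> subrep L"
  by (auto simp: subrep_def lsmult_def coeff_map_poly intro!: ideal_rmult[OF ideal_L])

lemma subrep_opx: "m \<in> subrep L \<Longrightarrow> opx m \<in> subrep L"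
  using ideal_rmult[OF ideal_L, of "snd m * idem N2" "tvar T21"]
    ideal_rmult[OF ideal_L, of "snd m * idem N2" "tvar T22_1"]
  by (auto simp: subrep_def opx_def coeff_pCons ideal_L split: nat.split)

lemma subrep_opy:
  assumes "m \<in> subrep L"
  shows "opy m \<in> subrep L"
proof -
  have 1: "c \<bullet> y1 \<in> subrep L" if "c * idem N1 \<in> L" for c
    using lsmult_mem_subrep[OF that, of y1]
    by (simp add: lsmult_def y1_def map_poly_pCons)
  have 2: "snd m \<bullet> y2 = (snd m * idem N2) \<bullet> y2"
    by (simp add: lsmult_def y2_def map_poly_pCons mult.assoc[symmetric])
  have "snd m \<bullet> y2 \<in> subrep L"
    unfolding 2 by (rule lsmult_mem_subrep) (use assms in \<open>simp add: subrep_def\<close>)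
  moreover have "horner (\<lambda>c. c \<bullet> y1) opx (fst m) \<in> subrep L"
    using assms by (intro horner_mem 1 subrep_opx subrep_add subrep_0) (auto simp: subrep_def lsmult_simps)
  ultimately show ?thesis
    unfolding opy_def by (intro subrep_add)
qed

lemma subrep_act_x: "m \<in> subrep L \<Longrightarrow> act_x p m \<in> subrep L"
  by (induction p) (auto simp: act_x_pCons intro: subrep_add subrep_lsmult subrep_opx)

lemma subrep_act: "m \<in> subrep L \<Longrightarrow> act a m \<in> subrep L"
  by (induction a) (auto simp: act_pCons intro: subrep_add subrep_act_x subrep_opy)

lemma subrep_trans: "m - m' \<in> subrep L \<Longrightarrow> m' - m'' \<in> subrep L \<Longrightarrow> m - m'' \<in> subrep L"
  using subrep_add[of "m - m'" "m' - m''"] by simp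

end

lemma opy_diff: "opy (m - m') = opy m - opy m'"
  using opy_add[of m "- m'"] additive_minus[of opy, OF opy_add] by simp

lemma opx_diff: "opx (m - m') = opx m - opx m'"
  using opx_add[of m "- m'"] additive_minus[of opx, OF opx_add] by simp

text \<open>
  For such an ideal the ordered action becomes an honest action of \<open>k[x,y]\<close> modulo \<open>subrep L\<close>.
\<close>
locale relations_ideal = two_sided_ideal L
  for L :: "'k::field free_alg set" +
  assumes rels: "rel_point \<in> L" "rel_line \<in> L"
begin

lemma opy_opx: "opy (opx m) - opx (opy m) \<in> subrep L"
proof -
  have "([:rel_line:], rel_point) \<in> subrep L"
    by (auto simp: subrep_def coeff_pCons intro: ideal_rmult[OF ideal_L] rels
        ideal_zero[OF ideal_L] split: nat.split)
  then show ?thesis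
    unfolding commutator by (simp add: subrep_lsmult)
qed

lemma opy_act_x: "opy (act_x p m) - act_x p (opy m) \<in> subrep L"
proof (induction p)
  case (pCons c p)
  have "opy (opx (act_x p m)) - opx (opy (act_x p m)) \<in> subrep L"
    by (rule opy_opx)
  moreover have "opx (opy (act_x p m)) - opx (act_x p (opy m)) \<in> subrep L"
    using subrep_opx[OF pCons.IH] by (simp add: opx_diff)
  ultimately show ?case
    using subrep_trans by (simp add: act_x_pCons opy_add opy_lsmult)
qed simp

lemma opy_act: "opy (act a m) - act a (opy m) \<in> subrep L"
proof (induction a)
  case (pCons p a)
  show ?case
    using subrep_add[OF opy_act_x[of p m] subrep_opy[OF pCons.IH]]
    by (simp add: act_pCons opy_add opy_diff algebra_simps)
qed simp

lemma act_mult: "act (a * b) m - act b (act a m) \<in> subrep L"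
proof (induction a)
  case (pCons p a)
  have "opy (act (a * b) m) - opy (act b (act a m)) \<in> subrep L"
    using subrep_opy[OF pCons.IH] by (simp add: opy_diff)
  then have "opy (act (a * b) m) - act b (opy (act a m)) \<in> subrep L"
    using opy_act subrep_trans by blast
  then show ?case
    by (simp add: act_add_poly act_smult act_pCons act_add)
qed simp

end


section \<open>The universal family over $S/J$\<close>

definition tcls :: "'k::field free_alg set \<Rightarrow> 'k rep \<Rightarrow> 'k tensor" where
  "tcls J m = (\<lambda>n. J +>\<^bsub>free_ring\<^esub> coeff (fst m) n * idem N1, J +>\<^bsub>free_ring\<^esub> snd m * idem N2)"

definition lift_rep :: "'k::field free_alg set \<Rightarrow> 'k tensor \<Rightarrow> 'k rep" where
  "lift_rep J t = (SOME m. tcls J m = t)"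

text \<open>
  The map to \<open>V\<close>, given by \<open>S \<rightarrow> S/\<mm> = k\<^sup>2\<close> on coefficients.
\<close>
definition reduce :: "'k::field rep \<Rightarrow> 'k poly \<times> 'k" where
  "reduce m = (map_poly (\<lambda>s. word_coeff s (N1, [])) (fst m), word_coeff (snd m) (N2, []))"

text \<open>
  The right action and the map to \<open>V\<close> are computed on an arbitrary representative of a class; they do
  not depend on it as soon as \<open>J\<close> is an ideal contained in \<open>\<mm>\<close>.
\<close>
definition universal :: "'k::field free_alg set \<Rightarrow> 'k deform" where
  "universal J = \<lparr>carrier = carrier (tensorV J), monoid.mult = undefined, one = undefined,
     ring.zero = \<zero>\<^bsub>tensorV J\<^esub>, add = add (tensorV J), module.smult = module.smult (tensorV J),
     ract = (\<lambda>t a. tcls J (act a (lift_rep J t))), toV = (\<lambda>t. reduce (lift_rep J t))\<rparr>"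

lemma coeff_reduce: "coeff (fst (reduce m)) n = word_coeff (coeff (fst m) n) (N1, [])"
  by (simp add: reduce_def coeff_map_poly)

lemma reduce_add: "reduce (m + m') = reduce m + reduce m'"
  by (simp add: prod_eq_iff poly_eq_iff coeff_reduce) (simp add: reduce_def)

lemma reduce_0 [simp]: "reduce 0 = 0"
  by (rule additive_zero[OF reduce_add])

lemma reduce_lsmult:
  "reduce (s \<bullet> m) = ([:word_coeff s (N1, []):] * fst (reduce m), word_coeff s (N2, []) * snd (reduce m))"
  by (simp add: prod_eq_iff poly_eq_iff coeff_reduce) (simp add: reduce_def lsmult_def coeff_map_poly)

lemma reduce_eq_0_iff: "reduce m = 0 \<longleftrightarrow> m \<in> subrep aug"
proof -
  have "x * idem j \<in> aug \<longleftrightarrow> word_coeff x (j, []) = 0" for x :: "'a free_alg" and j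
    by (auto simp: aug_iff idem.rep_eq)
  then show ?thesis
    by (simp add: prod_eq_iff poly_eq_iff coeff_reduce subrep_def) (simp add: reduce_def)
qed

lemma reduce_opx: "reduce (opx m) = ([:0, 1:] * fst (reduce m), 0)"
  by (simp add: prod_eq_iff poly_eq_iff coeff_reduce)
    (simp add: reduce_def opx_def coeff_pCons coeff_map_poly tvar.rep_eq split: nat.split)

lemma reduce_opy: "reduce (opy m) = 0"
proof -
  have "c \<bullet> y1 \<in> subrep aug" "c \<bullet> y2 \<in> subrep aug" for c :: "'a free_alg"
    by (auto simp: subrep_def lsmult_def y1_def y2_def map_poly_pCons coeff_pCons aug_iff
        tvar.rep_eq split: nat.split)
  moreover interpret two_sided_ideal "aug :: 'a free_alg set" by (rule two_sided_ideal.intro[OF ideal_aug])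
  have "horner (\<lambda>c. c \<bullet> y1) opx p \<in> subrep aug" for p :: "'a free_alg poly"
    by (intro horner_mem subrep_opx subrep_add subrep_0) (auto simp: calculation lsmult_simps)
  ultimately show ?thesis
    unfolding reduce_eq_0_iff opy_def by (intro subrep_add)
qed

lemma reduce_act_x: "reduce (act_x p m) = (p * fst (reduce m), poly p 0 * snd (reduce m))"
proof (induction p)
  case (pCons c p)
  then show ?case
    by (simp add: act_x_pCons reduce_add reduce_opx reduce_lsmult scalar.rep_eq)
qed (simp flip: zero_prod_def)

lemma reduce_act: "reduce (act a m) = actV (reduce m) a"
  by (induction a) (simp_all add: act_pCons reduce_add reduce_opy reduce_act_x actV_def mult.commute
      flip: zero_prod_def)

text \<open>
  The basis expansion; it reduces statements about additive \<open>S\<close>-linear maps to the basis.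
\<close>
lemma rep_decomposition:
  "m = (\<Sum>i\<le>degree (fst m). coeff (fst m) i \<bullet> (monom 1 i, 0)) + snd m \<bullet> (0, 1)"
proof -
  have 1: "s \<bullet> (monom 1 i, 0) = (monom s i, 0)" for s :: "'a free_alg" and i
    by (simp add: lsmult_def map_poly_monom)
  have 2: "(\<Sum>i\<in>A. (monom (c i) i, 0)) = (\<Sum>i\<in>A. monom (c i) i, 0 :: 'a free_alg)"
    for A and c :: "nat \<Rightarrow> 'a free_alg"
    by (induction A rule: infinite_finite_induct) (auto simp: zero_prod_def)
  show ?thesis
    unfolding 1 2 poly_as_sum_of_monoms by (simp add: lsmult_def)
qed

context two_sided_ideal
begin

lemma subrep_sum: "(\<And>a. a \<in> A \<Longrightarrow> f a \<in> subrep L) \<Longrightarrow> sum f A \<in> subrep L"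
  by (induction A rule: infinite_finite_induct) (auto intro: subrep_add)

lemma tcls_eq_iff: "tcls L m = tcls L m' \<longleftrightarrow> m - m' \<in> subrep L"
  by (auto simp: tcls_def subrep_def fun_eq_iff coset_eq_iff[OF ideal_L] left_diff_distrib)

lemma tcls_lift_rep [simp]: "tcls L (lift_rep L (tcls L m)) = tcls L m"
  unfolding lift_rep_def by (rule someI[of "\<lambda>m'. tcls L m' = tcls L m"]) simp

lemma lift_rep_tcls: "lift_rep L (tcls L m) - m \<in> subrep L"
  by (simp flip: tcls_eq_iff)

lemma carrier_tensorV: "carrier (tensorV L) = range (tcls L)"
proof (intro equalityI subsetI)
  fix t assume "t \<in> carrier (tensorV L)"
  then obtain f g where t: "t = (f, g)" and f: "\<And>n. f n \<in> quot_column L N1"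
    and fin: "finite {n. f n \<noteq> L +>\<^bsub>free_ring\<^esub> 0}" and g: "g \<in> quot_column L N2"
    by (auto simp: tensorV_def Let_def quot_simps[OF ideal_L])
  \<comment> \<open>representatives of zero cosets must be zero, so that the coefficients form a polynomial\<close>
  have "\<exists>s. f n = L +>\<^bsub>free_ring\<^esub> (s * idem N1) \<and> (f n = L +>\<^bsub>free_ring\<^esub> 0 \<longrightarrow> s = 0)" for n
    using f[of n] by (cases "f n = L +>\<^bsub>free_ring\<^esub> 0") (auto simp: quot_column_def)
  then obtain s where s: "\<And>n. f n = L +>\<^bsub>free_ring\<^esub> (s n * idem N1)"
      "\<And>n. f n = L +>\<^bsub>free_ring\<^esub> 0 \<Longrightarrow> s n = 0"
    by metis
  have "finite {n. s n \<noteq> 0}"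
    by (rule finite_subset[OF _ fin]) (use s(2) in auto)
  then have "coeff (Abs_poly s) = s"
    by (intro Abs_poly_inverse) (simp add: MOST_iff_cofinite)
  moreover obtain b where "g = L +>\<^bsub>free_ring\<^esub> (b * idem N2)"
    using g by (auto simp: quot_column_def)
  ultimately have "t = tcls L (Abs_poly s, b)"
    using s(1) by (auto simp: tcls_def t)
  then show "t \<in> range (tcls L)" by blast
next
  fix t assume "t \<in> range (tcls L)"
  then obtain p g where t: "t = tcls L (p, g)" by auto
  have "finite {n. L +>\<^bsub>free_ring\<^esub> coeff p n * idem N1 \<noteq> L +>\<^bsub>free_ring\<^esub> 0}"
    by (rule finite_subset[of _ "{n. coeff p n \<noteq> 0}"])
      (auto simp: MOST_coeff_eq_0 simp flip: MOST_iff_cofinite)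
  then show "t \<in> carrier (tensorV L)"
    unfolding t by (auto simp: tensorV_def Let_def quot_simps[OF ideal_L] tcls_def quot_column_def)
qed

lemma tensorV_simps:
  "tcls L m \<oplus>\<^bsub>tensorV L\<^esub> tcls L m' = tcls L (m + m')"
  "s \<odot>\<^bsub>tensorV L\<^esub> tcls L m = tcls L (s \<bullet> m)"
  "\<zero>\<^bsub>tensorV L\<^esub> = tcls L 0"
  by (simp_all add: tensorV_def Let_def tcls_def quot_simps[OF ideal_L] distrib_right
      lsmult_def coeff_map_poly mult.assoc)

lemma universal_simps:
  "carrier (universal L) = range (tcls L)"
  "tcls L m \<oplus>\<^bsub>universal L\<^esub> tcls L m' = tcls L (m + m')"
  "s \<odot>\<^bsub>universal L\<^esub> tcls L m = tcls L (s \<bullet> m)"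
  "\<zero>\<^bsub>universal L\<^esub> = tcls L 0"
  by (simp_all add: universal_def carrier_tensorV tensorV_simps)

lemma universal_ract: "tcls L m \<triangleleft>\<^bsub>universal L\<^esub> a = tcls L (act a m)"
proof -
  have "act a (lift_rep L (tcls L m)) - act a m = act a (lift_rep L (tcls L m) - m)"
    using act_add[of a "lift_rep L (tcls L m) - m" m] by simp
  then have "act a (lift_rep L (tcls L m)) - act a m \<in> subrep L"
    by (simp add: subrep_act lift_rep_tcls)
  then show ?thesis
    by (simp add: universal_def tcls_eq_iff)
qed

lemma universal_abelian_group: "abelian_group (universal L)"
proof (rule abelian_groupI)
  fix x assume "x \<in> carrier (universal L)"
  then obtain m where "x = tcls L m" by (auto simp: universal_simps)
  then show "\<exists>y\<in>carrier (universal L). y \<oplus>\<^bsub>universal L\<^esub> x = \<zero>\<^bsub>universal L\<^esub>"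
    by (intro bexI[of _ "tcls L (- m)"]) (auto simp: universal_simps)
qed (auto simp: universal_simps ac_simps)

lemma universal_uminus: "inv\<^bsub>add_monoid (universal L)\<^esub> (tcls L m) = tcls L (- m)"
proof -
  interpret abelian_group "universal L" by (rule universal_abelian_group)
  have "\<ominus>\<^bsub>universal L\<^esub> tcls L m = tcls L (- m)"
    by (rule minus_equality) (auto simp: universal_simps)
  then show ?thesis by (simp add: a_inv_def)
qed

lemma ideal_act_universal:
  assumes "ideal I free_ring"
  shows "ideal_act I (universal L) = tcls L ` subrep I"
proof
  interpret I: two_sided_ideal I by (rule two_sided_ideal.intro[OF assms])
  let ?G = "{s \<odot>\<^bsub>universal L\<^esub> m |s m. s \<in> I \<and> m \<in> carrier (universal L)}"
  have G: "x \<in> tcls L ` subrep I" if "x \<in> ?G" for x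
    using that by (auto simp: universal_simps intro: I.lsmult_mem_subrep)
  show "ideal_act I (universal L) \<subseteq> tcls L ` subrep I"
  proof
    fix x assume "x \<in> ideal_act I (universal L)"
    then show "x \<in> tcls L ` subrep I"
      unfolding ideal_act_def
    proof induction
      case one
      then show ?case by (auto simp: universal_simps)
    next
      case (incl h)
      then show ?case by (rule G)
    next
      case (inv h)
      then obtain m where "h = tcls L m" "m \<in> subrep I" using G by blast
      then show ?case by (simp add: universal_uminus I.subrep_minus)
    next
      case (eng h1 h2)
      then obtain m m' where "h1 = tcls L m" "m \<in> subrep I" "h2 = tcls L m'" "m' \<in> subrep I"
        by blast
      then have "h1 \<oplus>\<^bsub>universal L\<^esub> h2 = tcls L (m + m')" "m + m' \<in> subrep I"
        by (simp_all add: universal_simps I.subrep_add)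
      then show ?case by simp
    qed
  qed
  show "tcls L ` subrep I \<subseteq> ideal_act I (universal L)"
  proof
    fix t assume "t \<in> tcls L ` subrep I"
    then obtain p g where t: "t = tcls L (p, g)" and m: "(p, g) \<in> subrep I" by auto
    let ?D = "ideal_act I (universal L)"
    have gen: "tcls L (s \<bullet> m) \<in> ?D" if "s \<in> I" for s m
    proof -
      have "s \<odot>\<^bsub>universal L\<^esub> tcls L m \<in> ?G"
        unfolding universal_simps(1) using that by blast
      then show ?thesis
        unfolding ideal_act_def universal_simps(3) by (rule generate.incl)
    qed
    have add: "tcls L (m + m') \<in> ?D" if "tcls L m \<in> ?D" "tcls L m' \<in> ?D" for m m'
      using generate.eng[of _ "add_monoid (universal L)"] that
      unfolding ideal_act_def by (fastforce simp flip: universal_simps(2))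
    have zero: "tcls L 0 \<in> ?D"
      using generate.one[of "add_monoid (universal L)"]
      unfolding ideal_act_def by (fastforce simp flip: universal_simps(4))
    have sum: "tcls L (\<Sum>i\<in>A. (coeff p i * idem N1) \<bullet> (monom 1 i, 0)) \<in> ?D" for A
      using m by (induction A rule: infinite_finite_induct)
        (auto intro!: add gen zero simp: subrep_def)
    have "(p, g) - ((\<Sum>i\<le>degree p. (coeff p i * idem N1) \<bullet> (monom 1 i, 0))
        + (g * idem N2) \<bullet> (0, 1)) \<in> subrep L"
    proof -
      have e: "s \<bullet> m - (s * idem j) \<bullet> m = (s * (1 - idem j)) \<bullet> m" for s :: "'k free_alg" and m j
        by (metis add_diff_cancel_right' diff_add_cancel lsmult_simps(1) mult.right_neutral
            right_diff_distrib)
      have "(p, g) - ((\<Sum>i\<le>degree p. (coeff p i * idem N1) \<bullet> (monom 1 i, 0))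
            + (g * idem N2) \<bullet> (0, 1))
          = (\<Sum>i\<le>degree p. coeff p i \<bullet> (monom 1 i, 0) - (coeff p i * idem N1) \<bullet> (monom 1 i, 0))
            + (g \<bullet> (0, 1) - (g * idem N2) \<bullet> (0, 1))"
        by (subst rep_decomposition[of "(p, g)"]) (simp add: sum_subtractf)
      also have "\<dots> \<in> subrep L"
      proof (intro subrep_add)
        have *: "coeff p i \<bullet> (monom 1 i, 0) - (coeff p i * idem N1) \<bullet> (monom 1 i, 0) \<in> subrep L" for i
          unfolding e by (auto simp: subrep_def lsmult_def map_poly_monom algebra_simps
              ideal_zero[OF ideal_L])
        show "(\<Sum>i\<le>degree p. coeff p i \<bullet> (monom 1 i, 0) - (coeff p i * idem N1) \<bullet> (monom 1 i, 0)) \<in> subrep L"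
          by (rule subrep_sum) (rule *)
        show "g \<bullet> (0, 1) - (g * idem N2) \<bullet> (0, 1) \<in> subrep L"
          unfolding e by (auto simp: subrep_def lsmult_def algebra_simps ideal_zero[OF ideal_L])
      qed
      finally show ?thesis .
    qed
    then have "tcls L (p, g) = tcls L ((\<Sum>i\<le>degree p. (coeff p i * idem N1) \<bullet> (monom 1 i, 0))
        + (g * idem N2) \<bullet> (0, 1))"
      by (simp add: tcls_eq_iff)
    also have "\<dots> \<in> ?D"
      using m by (intro add sum gen) (simp add: subrep_def)
    finally show "t \<in> ?D" unfolding t .
  qed
qed

text \<open>
  The map to \<open>V\<close>, the lifting maps and the restriction to the line are all base changes of the family:
  such a map may be defined on representatives, where it only has to be linear with the right kernel.
\<close>
lemma base_change_universal:
  fixes h :: "'k rep \<Rightarrow> 'n" and N :: "('k free_alg, 'k poly poly, 'n, 'z) bimodule_scheme"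
  assumes "ideal I free_ring" "L \<subseteq> I"
    and ker: "\<And>m m'. h m = h m' \<longleftrightarrow> m - m' \<in> subrep I"
    and "range h = carrier N" "h 0 = \<zero>\<^bsub>N\<^esub>"
    and "\<And>m m'. h (m + m') = h m \<oplus>\<^bsub>N\<^esub> h m'"
    and "\<And>s m. h (s \<bullet> m) = s \<odot>\<^bsub>N\<^esub> h m"
    and "\<And>m a. h (act a m) = h m \<triangleleft>\<^bsub>N\<^esub> a"
  shows "h (lift_rep L (tcls L m)) = h m"
    and "base_change I (universal L) N (\<lambda>t. h (lift_rep L t))"
proof -
  have sub: "subrep L \<subseteq> subrep I" using \<open>L \<subseteq> I\<close> by (auto simp: subrep_def)
  have lift: "h (lift_rep L (tcls L m)) = h m" for m
    using lift_rep_tcls[of m] sub by (auto simp: ker)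
  show "h (lift_rep L (tcls L m)) = h m" by (rule lift)
  have "h (lift_rep L (tcls L m)) = \<zero>\<^bsub>N\<^esub> \<longleftrightarrow> m \<in> subrep I" for m
    using ker[of m 0] by (simp add: lift \<open>h 0 = \<zero>\<^bsub>N\<^esub>\<close>)
  then have "{x \<in> carrier (universal L). h (lift_rep L x) = \<zero>\<^bsub>N\<^esub>} = tcls L ` subrep I"
    unfolding universal_simps by blast
  moreover have "(\<lambda>t. h (lift_rep L t)) ` carrier (universal L) = carrier N"
    using assms(4) by (auto simp: universal_simps lift image_image)
  ultimately show "base_change I (universal L) N (\<lambda>t. h (lift_rep L t))"
    unfolding base_change_def ideal_act_universal[OF assms(1)]
    by (auto simp: universal_simps universal_ract lift assms)
qed

end

context relations_ideal
begin

lemma universal_free_bimodule: "free_bimodule (universal L)"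
  by (rule free_bimodule.intro[OF universal_abelian_group]; unfold_locales;
    unfold universal_simps(1); elim rangeE; hypsubst;
    unfold universal_simps universal_ract;
    (rule rangeI | simp add: lsmult_simps act_add_poly act_add act_lsmult act_one act_const
      tcls_eq_iff act_mult))

lemma universal_deformation:
  assumes "L \<subseteq> aug"
  shows "deformation L (universal L)"
  unfolding deformation_def
proof (intro conjI ballI)
  show "free_bimodule (universal L)" by (rule universal_free_bimodule)
  show "s \<odot>\<^bsub>universal L\<^esub> m = \<zero>\<^bsub>universal L\<^esub>" if "s \<in> L" "m \<in> carrier (universal L)" for s m
    using that by (auto simp: universal_simps tcls_eq_iff intro: lsmult_mem_subrep)
  show "left_isomorphic (universal L) (tensorV L)"
    unfolding left_isomorphic_def
    by (rule exI[of _ id]) (simp add: universal_def bij_betw_def)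
  have "base_change aug (universal L) moduleV (\<lambda>t. reduce (lift_rep L t))"
  proof (rule base_change_universal(2)[OF ideal_aug assms])
    fix m m' :: "'k rep"
    have "reduce m - reduce m' = reduce (m - m')"
      using reduce_add[of "m - m'" m'] by simp
    then show "reduce m = reduce m' \<longleftrightarrow> m - m' \<in> subrep aug"
      by (metis eq_iff_diff_eq_0 reduce_eq_0_iff)
    have "v \<in> range (reduce :: 'k rep \<Rightarrow> _)" for v
      by (rule range_eqI[of _ _ "(map_poly scalar (fst v), scalar (snd v))"])
        (simp add: prod_eq_iff poly_eq_iff coeff_reduce coeff_map_poly scalar_simps,
          simp add: reduce_def scalar.rep_eq)
    then show "range (reduce :: 'k rep \<Rightarrow> _) = carrier moduleV"
      by (auto simp: moduleV_def)
  qed (simp_all add: moduleV_def reduce_add reduce_lsmult reduce_act)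
  then show "base_change aug (universal L) moduleV (toV (universal L))"
    by (simp add: universal_def)
qed

end

lemma (in two_sided_ideal) toV_universal:
  assumes "L \<subseteq> aug"
  shows "toV (universal L) (tcls L m) = reduce m"
proof -
  have "lift_rep L (tcls L m) - m \<in> subrep aug"
    using lift_rep_tcls[of m] assms by (auto simp: subrep_def)
  then have "reduce (lift_rep L (tcls L m) - m) = 0" by (simp add: reduce_eq_0_iff)
  then have "reduce (lift_rep L (tcls L m)) = reduce m"
    using reduce_add[of "lift_rep L (tcls L m) - m" m] by simp
  then show ?thesis by (simp add: universal_def)
qed

lemma universal_lifts:
  assumes "relations_ideal L" "relations_ideal I" "L \<subseteq> I" "I \<subseteq> aug"
  shows "lifts_to I (universal I) L (universal L)"
proof -
  interpret L: relations_ideal L by fact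
  interpret I: relations_ideal I by fact
  have L: "L \<subseteq> aug" using assms by blast
  note bc = L.base_change_universal[OF I.ideal_L \<open>L \<subseteq> I\<close>, of "tcls I" "universal I",
      OF I.tcls_eq_iff I.universal_simps(1)[symmetric] I.universal_simps(4)[symmetric]
        I.universal_simps(2)[symmetric] I.universal_simps(3)[symmetric] I.universal_ract[symmetric]]
  have "toV (universal I) (tcls I (lift_rep L t)) = toV (universal L) t"
    if "t \<in> carrier (universal L)" for t
  proof -
    from that obtain m where "t = tcls L m" unfolding L.universal_simps(1) by blast
    then show ?thesis
      by (simp add: bc(1) I.toV_universal[OF \<open>I \<subseteq> aug\<close>] L.toV_universal[OF L])
  qed
  then show ?thesis
    unfolding lifts_to_def using bc(2) L.universal_deformation[OF L] by blast
qed


section \<open>The relations are forced\<close>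

text \<open>
  The subgroup \<open>L M\<close> is generated by products, so a map that is additive modulo an ideal is controlled
  on \<open>L M\<close> by its values on the products \<open>s m\<close>.
\<close>
lemma additive_mod_ideal_act:
  fixes M :: "('r, 'm, 'z) module_scheme" (structure) and G :: "'m \<Rightarrow> 'a::ring_1"
  assumes "abelian_group M" and T: "ideal T ring_of_type_algebra"
    and add: "\<And>m m'. m \<in> carrier M \<Longrightarrow> m' \<in> carrier M \<Longrightarrow> G (m \<oplus> m') - (G m + G m') \<in> T"
    and gen: "\<And>s m. s \<in> L \<Longrightarrow> m \<in> carrier M \<Longrightarrow> s \<odot> m \<in> carrier M \<and> G (s \<odot> m) \<in> T"
    and k: "k \<in> ideal_act L M"
  shows "k \<in> carrier M \<and> G k \<in> T"
  using k unfolding ideal_act_def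
proof induction
  interpret abelian_group M by fact
  have zero: "G \<zero> \<in> T"
    using add[of \<zero> \<zero>] by (simp add: T)
  {
    case one
    then show ?case using zero by simp
  next
    case (incl h)
    then show ?case using gen by auto
  next
    case (inv h)
    then have h: "h \<in> carrier M" "G h \<in> T" using gen by auto
    then have "G \<zero> - (G h + G (\<ominus> h)) \<in> T"
      using add[of h "\<ominus> h"] by (simp add: r_neg)
    from ideal_diff[OF T ideal_diff[OF T zero this] h(2)] have "G (\<ominus> h) \<in> T" by simp
    with h show ?case by (simp add: a_inv_def[symmetric])
  next
    case (eng h1 h2)
    then have "G (h1 \<oplus> h2) - (G h1 + G h2) \<in> T" by (intro add) auto
    from ideal_add[OF T this ideal_add[OF T, of "G h1" "G h2"]] eng show ?case by simp
  }
qed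

text \<open>
  Let \<open>lam\<close> be a linear form on \<open>V\<^sub>i\<close>. It extends to a coordinate \<open>F\<close> on any deformation \<open>M\<close> over \<open>S/I\<close>:
  transported along \<open>M \<cong> S/I \<otimes>\<^bsub>k\<^sup>2\<^esub> V\<close>, \<open>F\<close> maps \<open>s \<otimes> b\<close> to \<open>s\<close> times the value of \<open>lam\<close> at the image of
  \<open>1 \<otimes> b\<close> in \<open>V\<close>. The given left module isomorphism need not respect the maps to \<open>V\<close>, and this choice of
  values corrects the difference. The values of \<open>F\<close> are representatives in \<open>S\<close>, hence the congruences.
\<close>
lemma coordinate_functional:
  fixes M :: "'k::field deform" and lam :: "'k poly \<times> 'k \<Rightarrow> 'k"
  assumes I: "ideal I free_ring" and M: "deformation I M"
    and lam_add: "\<And>v w. lam (v + w) = lam v + lam w"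
    and lam_smult: "\<And>s v. lam (s \<odot>\<^bsub>moduleV\<^esub> v) = word_coeff s (i, []) * lam v"
  obtains F where
    "\<And>m m'. m \<in> carrier M \<Longrightarrow> m' \<in> carrier M \<Longrightarrow> F (m \<oplus>\<^bsub>M\<^esub> m') - (F m + F m') \<in> I"
    "\<And>s m. m \<in> carrier M \<Longrightarrow> F (s \<odot>\<^bsub>M\<^esub> m) - s * F m \<in> I"
    "\<And>m. m \<in> carrier M \<Longrightarrow> F m - scalar (lam (toV M m)) * idem i \<in> aug"
proof -
  interpret I: two_sided_ideal I by (rule two_sided_ideal.intro[OF I])
  interpret M: free_bimodule M using M by (simp add: deformation_def)
  from M obtain \<phi> where bij: "bij_betw \<phi> (carrier M) (range (tcls I))"
    and \<phi>_add: "\<And>m m'. m \<in> carrier M \<Longrightarrow> m' \<in> carrier M \<Longrightarrow> \<phi> (m \<oplus>\<^bsub>M\<^esub> m') = \<phi> m \<oplus>\<^bsub>tensorV I\<^esub> \<phi> m'"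
    and \<phi>_smult: "\<And>s m. m \<in> carrier M \<Longrightarrow> \<phi> (s \<odot>\<^bsub>M\<^esub> m) = s \<odot>\<^bsub>tensorV I\<^esub> \<phi> m"
    unfolding deformation_def left_isomorphic_def I.carrier_tensorV by blast
  have V: "m \<in> carrier M \<Longrightarrow> m' \<in> carrier M \<Longrightarrow> toV M (m \<oplus>\<^bsub>M\<^esub> m') = toV M m + toV M m'"
    "m \<in> carrier M \<Longrightarrow> toV M (s \<odot>\<^bsub>M\<^esub> m) = s \<odot>\<^bsub>moduleV\<^esub> toV M m" for s m m'
    using M by (auto simp: deformation_def base_change_def moduleV_def)
  define \<psi> where "\<psi> t = inv_into (carrier M) \<phi> (tcls I t)" for t
  have \<psi>: "\<psi> t \<in> carrier M" "\<phi> (\<psi> t) = tcls I t" for t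
    unfolding \<psi>_def using bij by (auto simp: bij_betw_def f_inv_into_f inv_into_into)
  have \<psi>_eqI: "m = \<psi> t" if "m \<in> carrier M" "\<phi> m = tcls I t" for m t
    using that \<psi>[of t] bij by (metis bij_betw_def inj_onD)
  have \<psi>_add: "\<psi> (t + t') = \<psi> t \<oplus>\<^bsub>M\<^esub> \<psi> t'" for t t'
    by (rule \<psi>_eqI[symmetric]) (simp_all add: \<psi> \<phi>_add I.tensorV_simps)
  have \<psi>_lsmult: "\<psi> (s \<bullet> t) = s \<odot>\<^bsub>M\<^esub> \<psi> t" for s t
    by (rule \<psi>_eqI[symmetric]) (simp_all add: \<psi> \<phi>_smult I.tensorV_simps M.smult_closed)
  define \<mu> where "\<mu> t = lam (toV M (\<psi> t))" for t
  have \<mu>_add: "\<mu> (t + t') = \<mu> t + \<mu> t'" for t t'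
    by (simp add: \<mu>_def \<psi>_add V \<psi> lam_add)
  have \<mu>_lsmult: "\<mu> (s \<bullet> t) = word_coeff s (i, []) * \<mu> t" for s t
    by (simp add: \<mu>_def \<psi>_lsmult V \<psi> lam_smult)
  have \<mu>_sum: "\<mu> (\<Sum>n\<in>A. f n) = (\<Sum>n\<in>A. \<mu> (f n))" for f and A :: "nat set"
    using additive_zero[of \<mu>, OF \<mu>_add] by (induction A rule: infinite_finite_induct) (auto simp: \<mu>_add)
  have \<mu>_cong: "\<mu> t = \<mu> t'" if "t - t' \<in> subrep I" for t t'
    using that unfolding \<mu>_def \<psi>_def by (simp flip: I.tcls_eq_iff)
  have \<mu>_idem: "\<mu> t = word_coeff (idem j) (i, []) * \<mu> t" if "t - idem j \<bullet> t \<in> subrep I" for t j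
    using \<mu>_cong[OF that] by (simp add: \<mu>_lsmult)
  define \<gamma> where "\<gamma> n = \<mu> (monom 1 n, 0)" for n
  define \<delta> where "\<delta> = \<mu> (0, 1)"
  have \<gamma>: "\<gamma> n = word_coeff (idem N1) (i, []) * \<gamma> n" for n
    unfolding \<gamma>_def
    by (rule \<mu>_idem) (auto simp: subrep_def lsmult_def map_poly_monom left_diff_distrib ideal_zero[OF I])
  have \<delta>: "\<delta> = word_coeff (idem N2) (i, []) * \<delta>"
    unfolding \<delta>_def
    by (rule \<mu>_idem) (auto simp: subrep_def lsmult_def left_diff_distrib ideal_zero[OF I])
  \<comment> \<open>\<open>F0 t\<close> is the basis expansion of \<open>t\<close> with \<open>v\<^sub>1 x\<^sup>n\<close> and \<open>v\<^sub>2\<close> replaced by the values of \<open>\<mu>\<close>\<close>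
  define F0 where "F0 t = (\<Sum>n\<le>degree (fst t). coeff (fst t) n * idem N1 * scalar (\<gamma> n))
      + snd t * idem N2 * scalar \<delta>" for t :: "'k rep"
  have F0: "F0 t = (\<Sum>n\<le>N. coeff (fst t) n * idem N1 * scalar (\<gamma> n)) + snd t * idem N2 * scalar \<delta>"
    if "degree (fst t) \<le> N" for t N
    unfolding F0_def using that
    by (intro arg_cong2[of _ _ _ _ "(+)"] sum.mono_neutral_left) (auto simp: coeff_eq_0)
  have F0_add: "F0 (t + t') = F0 t + F0 t'" for t t'
  proof -
    define N where "N = max (degree (fst t)) (degree (fst t'))"
    have "degree (fst (t + t')) \<le> N" by (simp add: N_def degree_add_le_max)
    moreover have "degree (fst t) \<le> N" "degree (fst t') \<le> N" by (auto simp: N_def)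
    ultimately show ?thesis
      by (simp add: F0[of _ N] distrib_right sum.distrib)
  qed
  have F0_lsmult: "F0 (s \<bullet> t) = s * F0 t" for s t
  proof -
    have "degree (fst (s \<bullet> t)) \<le> degree (fst t)"
      by (intro degree_le) (simp add: lsmult_def coeff_map_poly coeff_eq_0)
    then show ?thesis
      by (simp add: F0[of _ "degree (fst t)"] lsmult_def coeff_map_poly distrib_left sum_distrib_left mult.assoc)
  qed
  have F0_subrep: "F0 t \<in> I" if "t \<in> subrep I" for t
    using that unfolding F0_def subrep_def
    by (auto intro!: ideal_add[OF I] ideal_sum[OF I] ideal_rmult[OF I, of "_ * idem _"])
  have F0_aug: "F0 t - scalar (\<mu> t) * idem i \<in> aug" for t
  proof -
    have mu: "\<mu> t = (\<Sum>n\<le>degree (fst t). word_coeff (coeff (fst t) n) (i, []) * \<gamma> n)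
        + word_coeff (snd t) (i, []) * \<delta>"
      by (subst rep_decomposition[of t]) (simp add: \<mu>_add \<mu>_sum \<mu>_lsmult \<gamma>_def \<delta>_def)
    have "word_coeff (F0 t) (j, []) = (if j = i then \<mu> t else 0)" for j
    proof -
      have "word_coeff (coeff (fst t) n) (j, []) * word_coeff (idem N1) (j, []) * \<gamma> n
          = (if j = i then word_coeff (coeff (fst t) n) (i, []) * \<gamma> n else 0)" for n
        using \<gamma>[of n] by (auto simp: idem.rep_eq split: if_splits)
      moreover have "word_coeff (snd t) (j, []) * word_coeff (idem N2) (j, []) * \<delta>
          = (if j = i then word_coeff (snd t) (i, []) * \<delta> else 0)"
        using \<delta> by (auto simp: idem.rep_eq split: if_splits)
      ultimately show ?thesis
        by (simp add: F0_def mu word_coeff_sum scalar.rep_eq)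
    qed
    then show ?thesis
      by (auto simp: aug_iff scalar.rep_eq idem.rep_eq)
  qed
  define F where "F m = F0 (lift_rep I (\<phi> m))" for m
  have lift: "tcls I (lift_rep I (\<phi> m)) = \<phi> m" if "m \<in> carrier M" for m
  proof -
    have "\<phi> m \<in> range (tcls I)" using bij_betw_apply[OF bij that] .
    then obtain t where "\<phi> m = tcls I t" by blast
    then show ?thesis by simp
  qed
  have F0_cong: "F0 t - F0 t' \<in> I" if "tcls I t = tcls I t'" for t t'
  proof -
    have "F0 (t - t') \<in> I" using that by (intro F0_subrep) (simp add: I.tcls_eq_iff)
    moreover have "F0 t = F0 (t - t') + F0 t'" by (simp flip: F0_add)
    ultimately show ?thesis by simp
  qed
  show thesis
  proof (rule that)
    fix m m' assume m: "m \<in> carrier M" "m' \<in> carrier M"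
    show "F (m \<oplus>\<^bsub>M\<^esub> m') - (F m + F m') \<in> I"
      unfolding F_def F0_add[symmetric]
      by (rule F0_cong) (unfold lift[OF M.a_closed[OF m]] I.tensorV_simps(1)[symmetric] lift[OF m(1)] lift[OF m(2)],
          rule \<phi>_add[OF m])
  next
    fix m s assume m: "m \<in> carrier M"
    show "F (s \<odot>\<^bsub>M\<^esub> m) - s * F m \<in> I"
      unfolding F_def F0_lsmult[symmetric]
      by (rule F0_cong) (unfold lift[OF M.smult_closed[OF m]] I.tensorV_simps(2)[symmetric] lift[OF m], rule \<phi>_smult[OF m])
    have "m = \<psi> (lift_rep I (\<phi> m))"
      by (rule \<psi>_eqI) (simp_all add: m lift)
    then show "F m - scalar (lam (toV M m)) * idem i \<in> aug"
      using F0_aug[of "lift_rep I (\<phi> m)"] by (simp add: F_def \<mu>_def)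
  qed
qed

text \<open>
  The heart of the minimality: a linear form on \<open>V\<^sub>i\<close> that kills \<open>V x\<close> and \<open>V y\<close> turns a lifting over \<open>S/I\<close>
  into a congruence between the relations modulo \<open>I\<close>. It will be used for the constant coefficient
  on \<open>V\<^sub>1 = k[x]\<close> and for the identity on \<open>V\<^sub>2 = k\<close>, which give one relation each.
\<close>
lemma relations_forced:
  fixes M :: "'k::field deform" and lam :: "'k poly \<times> 'k \<Rightarrow> 'k"
  assumes J: "relations_ideal J" "J \<subseteq> aug" and I: "ideal I free_ring" "I \<subseteq> J"
    and small: "\<And>s j. s \<in> aug \<Longrightarrow> j \<in> J \<Longrightarrow> s * j \<in> I \<and> j * s \<in> I"
    and lifts: "lifts_to J (universal J) I M"
    and lam_add: "\<And>v w. lam (v + w) = lam v + lam w"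
    and lam_smult: "\<And>s v. lam (s \<odot>\<^bsub>moduleV\<^esub> v) = word_coeff s (i, []) * lam v"
    and lam_x: "\<And>v. lam (actV v [:[:0, 1:]:]) = 0" and lam_y: "\<And>v. lam (actV v [:0, 1:]) = 0"
  shows "rel_line * scalar (lam (1, 0)) * idem i + rel_point * scalar (lam (0, 1)) * idem i \<in> I"
proof -
  interpret J: relations_ideal J by fact
  note JJ = J.ideal_L
  have M: "deformation I M" using lifts by (simp add: lifts_to_def)
  interpret M: free_bimodule M using M by (simp add: deformation_def)
  from lifts obtain \<pi> where bc: "base_change J M (universal J) \<pi>"
    and toV: "\<And>m. m \<in> carrier M \<Longrightarrow> toV (universal J) (\<pi> m) = toV M m"
    by (auto simp: lifts_to_def)
  have \<pi>_surj: "\<pi> ` carrier M = range (tcls J)"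
    and \<pi>_ker: "\<And>m. m \<in> carrier M \<Longrightarrow> \<pi> m = tcls J 0 \<Longrightarrow> m \<in> ideal_act J M"
    and \<pi>_add: "\<And>m m'. m \<in> carrier M \<Longrightarrow> m' \<in> carrier M \<Longrightarrow> \<pi> (m \<oplus>\<^bsub>M\<^esub> m') = \<pi> m \<oplus>\<^bsub>universal J\<^esub> \<pi> m'"
    and \<pi>_smult: "\<And>s m. m \<in> carrier M \<Longrightarrow> \<pi> (s \<odot>\<^bsub>M\<^esub> m) = s \<odot>\<^bsub>universal J\<^esub> \<pi> m"
    and \<pi>_ract: "\<And>a m. m \<in> carrier M \<Longrightarrow> \<pi> (m \<triangleleft>\<^bsub>M\<^esub> a) = \<pi> m \<triangleleft>\<^bsub>universal J\<^esub> a"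
    using bc unfolding base_change_def J.universal_simps by blast+
  have "tcls J ([:1:], 0) \<in> \<pi> ` carrier M" "tcls J (0, 1) \<in> \<pi> ` carrier M"
    unfolding \<pi>_surj by blast+
  then obtain v1 v2 where v: "v1 \<in> carrier M" "v2 \<in> carrier M"
    and \<pi>_v: "\<pi> v1 = tcls J ([:1:], 0)" "\<pi> v2 = tcls J (0, 1)"
    by fastforce
  have toV_v: "toV M v1 = (1, 0)" "toV M v2 = (0, 1)"
    using toV[OF v(1)] toV[OF v(2)] J.toV_universal[OF J(2)]
    by (auto simp: \<pi>_v reduce_def one_free_alg.rep_eq map_poly_pCons one_pCons)
  note closed = v M.smult_closed M.ract_closed M.a_closed
  let ?x = "[:[:0, 1:]:] :: 'k poly poly" and ?y = "[:0, 1:] :: 'k poly poly"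
  \<comment> \<open>the errors in the three defining equations\<close>
  define k1 where "k1 = v2 \<triangleleft>\<^bsub>M\<^esub> ?x \<oplus>\<^bsub>M\<^esub> (tvar T21 \<odot>\<^bsub>M\<^esub> v1 \<oplus>\<^bsub>M\<^esub> tvar T22_1 \<odot>\<^bsub>M\<^esub> v2)"
  define k2 where "k2 = v2 \<triangleleft>\<^bsub>M\<^esub> ?y \<oplus>\<^bsub>M\<^esub> (tvar T22_2 \<odot>\<^bsub>M\<^esub> v2 \<oplus>\<^bsub>M\<^esub> (- (tvar T21 * tvar T11)) \<odot>\<^bsub>M\<^esub> v1)"
  define k3 where "k3 = v1 \<triangleleft>\<^bsub>M\<^esub> ?y \<oplus>\<^bsub>M\<^esub> (tvar T11 \<odot>\<^bsub>M\<^esub> (v1 \<triangleleft>\<^bsub>M\<^esub> ?x) \<oplus>\<^bsub>M\<^esub> tvar T12 \<odot>\<^bsub>M\<^esub> v2)"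
  have k: "k1 \<in> ideal_act J M" "k2 \<in> ideal_act J M" "k3 \<in> ideal_act J M"
    unfolding k1_def k2_def k3_def
    by (rule \<pi>_ker;
        simp add: closed \<pi>_add \<pi>_smult \<pi>_ract \<pi>_v J.universal_ract J.universal_simps act_xA act_yA;
        simp add: opx_def opy_def lsmult_def y1_def y2_def map_poly_pCons horner_pCons zero_prod_def)+
  obtain F where
    F_add: "\<And>m m'. m \<in> carrier M \<Longrightarrow> m' \<in> carrier M \<Longrightarrow> F (m \<oplus>\<^bsub>M\<^esub> m') - (F m + F m') \<in> I"
    and F_smult: "\<And>s m. m \<in> carrier M \<Longrightarrow> F (s \<odot>\<^bsub>M\<^esub> m) - s * F m \<in> I"
    and F_aug: "\<And>m. m \<in> carrier M \<Longrightarrow> F m - scalar (lam (toV M m)) * idem i \<in> aug"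
    by (rule coordinate_functional[OF I(1) M, of lam i]) (use lam_add lam_smult in auto)
  have F_lc: "F (a \<oplus>\<^bsub>M\<^esub> (s \<odot>\<^bsub>M\<^esub> b \<oplus>\<^bsub>M\<^esub> t \<odot>\<^bsub>M\<^esub> c)) - (F a + s * F b + t * F c) \<in> I"
    if "a \<in> carrier M" "b \<in> carrier M" "c \<in> carrier M" for a b c s t
  proof -
    have 1: "F (a \<oplus>\<^bsub>M\<^esub> (s \<odot>\<^bsub>M\<^esub> b \<oplus>\<^bsub>M\<^esub> t \<odot>\<^bsub>M\<^esub> c)) - (F a + F (s \<odot>\<^bsub>M\<^esub> b \<oplus>\<^bsub>M\<^esub> t \<odot>\<^bsub>M\<^esub> c)) \<in> I"
      by (intro F_add closed that)
    have 2: "F (s \<odot>\<^bsub>M\<^esub> b \<oplus>\<^bsub>M\<^esub> t \<odot>\<^bsub>M\<^esub> c) - (F (s \<odot>\<^bsub>M\<^esub> b) + F (t \<odot>\<^bsub>M\<^esub> c)) \<in> I"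
      by (intro F_add closed that)
    note 3 = F_smult[OF that(2), of s] F_smult[OF that(3), of t]
    from ideal_add[OF I(1) ideal_add[OF I(1) 1 2] ideal_add[OF I(1) 3]]
    show ?thesis by (simp add: algebra_simps)
  qed
  have F_k: "F k \<in> J" if "k \<in> ideal_act J M" for k
  proof -
    have "k \<in> carrier M \<and> F k \<in> J"
    proof (rule additive_mod_ideal_act[OF M.abelian_group_axioms JJ _ _ that])
      fix s m assume "s \<in> J" "m \<in> carrier M"
      then show "s \<odot>\<^bsub>M\<^esub> m \<in> carrier M \<and> F (s \<odot>\<^bsub>M\<^esub> m) \<in> J"
        using ideal_add[OF JJ subsetD[OF I(2) F_smult] ideal_rmult[OF JJ], of m s s "F m"]
        by (simp add: closed)
    qed (use F_add I(2) in blast)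
    then show ?thesis ..
  qed
  have F_act: "F (k \<triangleleft>\<^bsub>M\<^esub> a) \<in> I" if "k \<in> ideal_act J M" and a: "\<And>v. lam (actV v a) = 0" for k a
  proof -
    have toV_ract: "toV M (m \<triangleleft>\<^bsub>M\<^esub> a) = actV (toV M m) a" if "m \<in> carrier M" for m
      using M that by (auto simp: deformation_def base_change_def moduleV_def)
    have "k \<in> carrier M \<and> F (k \<triangleleft>\<^bsub>M\<^esub> a) \<in> I"
    proof (rule additive_mod_ideal_act[OF M.abelian_group_axioms I(1) _ _ that(1)])
      fix m m' assume "m \<in> carrier M" "m' \<in> carrier M"
      then show "F ((m \<oplus>\<^bsub>M\<^esub> m') \<triangleleft>\<^bsub>M\<^esub> a) - (F (m \<triangleleft>\<^bsub>M\<^esub> a) + F (m' \<triangleleft>\<^bsub>M\<^esub> a)) \<in> I"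
        by (simp add: M.ract_add_left F_add closed)
    next
      fix s m assume s: "s \<in> J" and m: "m \<in> carrier M"
      have "F (m \<triangleleft>\<^bsub>M\<^esub> a) \<in> aug"
        using F_aug[of "m \<triangleleft>\<^bsub>M\<^esub> a"] by (simp add: closed m toV_ract a scalar_simps)
      then have "s * F (m \<triangleleft>\<^bsub>M\<^esub> a) \<in> I" using small s by blast
      from ideal_add[OF I(1) F_smult[of "m \<triangleleft>\<^bsub>M\<^esub> a" s] this]
      show "s \<odot>\<^bsub>M\<^esub> m \<in> carrier M \<and> F ((s \<odot>\<^bsub>M\<^esub> m) \<triangleleft>\<^bsub>M\<^esub> a) \<in> I"
        by (simp add: closed m M.smult_ract)
    qed
    then show ?thesis ..
  qed
  define A where "A = F (v2 \<triangleleft>\<^bsub>M\<^esub> ?x)"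
  define B where "B = F (v2 \<triangleleft>\<^bsub>M\<^esub> ?y)"
  define C where "C = F (v1 \<triangleleft>\<^bsub>M\<^esub> ?x)"
  define D where "D = F (v1 \<triangleleft>\<^bsub>M\<^esub> ?y)"
  define E where "E = F (v2 \<triangleleft>\<^bsub>M\<^esub> (?x * ?y))"
  have e1: "F k1 - (A + tvar T21 * F v1 + tvar T22_1 * F v2) \<in> I"
    unfolding k1_def A_def by (intro F_lc closed)
  have e2: "F k2 - (B + tvar T22_2 * F v2 + (- (tvar T21 * tvar T11)) * F v1) \<in> I"
    unfolding k2_def B_def by (intro F_lc closed)
  have e3: "F k3 - (D + tvar T11 * C + tvar T12 * F v2) \<in> I"
    unfolding k3_def D_def C_def by (intro F_lc closed)
  have "k1 \<triangleleft>\<^bsub>M\<^esub> ?y = v2 \<triangleleft>\<^bsub>M\<^esub> (?x * ?y) \<oplus>\<^bsub>M\<^esub> (tvar T21 \<odot>\<^bsub>M\<^esub> (v1 \<triangleleft>\<^bsub>M\<^esub> ?y) \<oplus>\<^bsub>M\<^esub> tvar T22_1 \<odot>\<^bsub>M\<^esub> (v2 \<triangleleft>\<^bsub>M\<^esub> ?y))"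
    by (simp add: k1_def M.ract_add_left closed M.smult_ract M.ract_mult del: mult_pCons_left mult_pCons_right)
  then have e4: "F (k1 \<triangleleft>\<^bsub>M\<^esub> ?y) - (E + tvar T21 * D + tvar T22_1 * B) \<in> I"
    unfolding E_def D_def B_def by (simp only:) (intro F_lc closed)
  have "k2 \<triangleleft>\<^bsub>M\<^esub> ?x = v2 \<triangleleft>\<^bsub>M\<^esub> (?y * ?x) \<oplus>\<^bsub>M\<^esub> (tvar T22_2 \<odot>\<^bsub>M\<^esub> (v2 \<triangleleft>\<^bsub>M\<^esub> ?x)
      \<oplus>\<^bsub>M\<^esub> (- (tvar T21 * tvar T11)) \<odot>\<^bsub>M\<^esub> (v1 \<triangleleft>\<^bsub>M\<^esub> ?x))"
    by (simp add: k2_def M.ract_add_left closed M.smult_ract M.ract_mult del: mult_pCons_left mult_pCons_right)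
  then have e5: "F (k2 \<triangleleft>\<^bsub>M\<^esub> ?x) - (E + tvar T22_2 * A + (- (tvar T21 * tvar T11)) * C) \<in> I"
    unfolding E_def A_def C_def mult.commute[of ?y] by (simp only:) (intro F_lc closed)
  have m: "tvar a * F k1 \<in> I" "tvar a * F k2 \<in> I" "tvar a * F k3 \<in> I" for a
    using small[OF aug_gen F_k] k by blast+
  \<comment> \<open>expand \<open>F (v\<^sub>2 x y) = F (v\<^sub>2 y x)\<close> and eliminate \<open>A\<close>, \<open>B\<close>, \<open>C\<close>, \<open>D\<close>\<close>
  note c = ideal_add[OF I(1)] ideal_diff[OF I(1)] ideal_lmult[OF I(1)]
  have "(F (k1 \<triangleleft>\<^bsub>M\<^esub> ?y) - (E + tvar T21 * D + tvar T22_1 * B))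
      - (F (k2 \<triangleleft>\<^bsub>M\<^esub> ?x) - (E + tvar T22_2 * A + (- (tvar T21 * tvar T11)) * C))
      - F (k1 \<triangleleft>\<^bsub>M\<^esub> ?y) + F (k2 \<triangleleft>\<^bsub>M\<^esub> ?x)
      + tvar T22_2 * (F k1 - (A + tvar T21 * F v1 + tvar T22_1 * F v2)) - tvar T22_2 * F k1
      - tvar T22_1 * (F k2 - (B + tvar T22_2 * F v2 + (- (tvar T21 * tvar T11)) * F v1)) + tvar T22_1 * F k2
      - tvar T21 * (F k3 - (D + tvar T11 * C + tvar T12 * F v2)) + tvar T21 * F k3 \<in> I" (is "?s \<in> I")
    by (intro c e1 e2 e3 e4 e5 m F_act k lam_x lam_y)
  also have "?s = - (rel_line * F v1 + rel_point * F v2)"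
    by (simp add: rel_line_def rel_point_def algebra_simps)
  finally have 1: "rel_line * F v1 + rel_point * F v2 \<in> I"
    unfolding ideal_minus_iff[OF I(1)] .
  have "rel_line * (F v1 - scalar (lam (1, 0)) * idem i) \<in> I"
    "rel_point * (F v2 - scalar (lam (0, 1)) * idem i) \<in> I"
    using small F_aug v J.rels toV_v by metis+
  from ideal_diff[OF I(1) 1 ideal_add[OF I(1) this]]
  show ?thesis by (simp add: algebra_simps)
qed


section \<open>The line deforms to lines through the origin\<close>

lemma coeff_to_t11: "coeff (to_t11 x) n = word_coeff x (N1, replicate n T11)"
  by (simp add: to_t11.rep_eq)

lemma last_idx_replicate_T11: "last_idx N1 (replicate n T11) = N1"
  by (induction n) auto

lemma to_t11_add: "to_t11 (x + y) = to_t11 x + to_t11 y"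
  by (simp add: poly_eq_iff coeff_to_t11)

lemma to_t11_minus: "to_t11 (- x) = - to_t11 x"
  by (simp add: poly_eq_iff coeff_to_t11)

lemma to_t11_diff: "to_t11 (x - y) = to_t11 x - to_t11 y"
  by (simp add: poly_eq_iff coeff_to_t11)

lemma to_t11_0 [simp]: "to_t11 0 = 0"
  by (simp add: poly_eq_iff coeff_to_t11)

lemma to_t11_mult: "to_t11 (x * y) = to_t11 x * to_t11 y"
proof (rule poly_eqI)
  fix n
  have "word_coeff (x * y) (N1, replicate n T11)
      = (\<Sum>l\<le>n. word_coeff x (N1, replicate l T11) * word_coeff y (N1, replicate (n - l) T11))"
    unfolding word_coeff_times by (simp add: min_def last_idx_replicate_T11)
  then show "coeff (to_t11 (x * y)) n = coeff (to_t11 x * to_t11 y) n"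
    by (simp add: coeff_to_t11 coeff_mult)
qed

lemma to_t11_idem: "to_t11 (idem N1) = 1" "to_t11 (idem N2) = 0"
  by (auto simp: poly_eq_iff coeff_to_t11 idem.rep_eq)

lemma to_t11_scalar: "to_t11 (scalar c) = [:c:]"
  by (auto simp: poly_eq_iff coeff_to_t11 scalar.rep_eq coeff_pCons split: nat.split)

lemma replicate_eq_singleton: "replicate n b = [a] \<longleftrightarrow> n = 1 \<and> b = a"
  by (cases n) auto

lemma to_t11_tvar:
  "to_t11 (tvar T11) = [:0, 1:]" "to_t11 (tvar T12) = 0" "to_t11 (tvar T21) = 0"
  "to_t11 (tvar T22_1) = 0" "to_t11 (tvar T22_2) = 0"
  by (auto simp: poly_eq_iff coeff_to_t11 tvar.rep_eq coeff_pCons replicate_eq_singleton split: nat.split)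

lemma X_power_dvd_iff: "[:0, 1:] ^ n dvd p \<longleftrightarrow> (\<forall>k<n. coeff p k = 0)" for p :: "'a::field poly"
  using monom_1_dvd_iff'[of n p] by (simp add: monom_altdef)

text \<open>
  Killing \<open>t\<^sub>1\<^sub>2\<close>, \<open>t\<^sub>2\<^sub>1\<close> and \<open>e\<^sub>2\<close> leaves only the powers of \<open>t\<^sub>1\<^sub>1\<close>: a composable word that starts at \<open>1\<close>
  either stays there or meets \<open>t\<^sub>1\<^sub>2\<close>.
\<close>
lemma word_T11_or_killed:
  assumes "ideal I free_ring" "tvar T12 \<in> I" "tvar T21 \<in> I" "idem N2 \<in> I"
  shows "word i ws \<in> I \<or> i = N1 \<and> ws = replicate (length ws) T11"
proof (induction ws arbitrary: i)
  case Nil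
  then show ?case using assms by (cases i) (auto simp: word_Nil)
next
  case (Cons a ws)
  have T22: "tvar a \<in> I" if "row a = N2"
    using ideal_rmult[OF assms(1,4), of "tvar a"] that by simp
  show ?case
  proof (cases a)
    case T11
    then show ?thesis
      using Cons.IH[of N1] ideal_lmult[OF assms(1), of "word N1 ws" "tvar T11"] ideal_zero[OF assms(1)]
      by (auto simp: word_Cons)
  qed (use T22 assms ideal_zero[OF assms(1)] in \<open>auto simp: word_Cons intro: ideal_rmult[OF assms(1)]\<close>)
qed

text \<open>The kernel of \<open>S \<rightarrow> k[t\<^sub>1\<^sub>1]/(t\<^sub>1\<^sub>1\<^sup>n)\<close>.\<close>
lemma line_kernel:
  fixes J :: "'k::field free_alg set"
  assumes "aug_pow n \<subseteq> J" "\<And>j. j \<in> J \<Longrightarrow> [:0, 1:] ^ n dvd to_t11 j"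
  shows "x \<in> Idl\<^bsub>free_ring\<^esub> (J \<union> {tvar T12, tvar T21, idem N2}) \<longleftrightarrow> [:0, 1:] ^ n dvd to_t11 x"
    (is "x \<in> ?L \<longleftrightarrow> _")
proof
  assume "x \<in> ?L"
  moreover have "?L \<subseteq> {x. [:0, 1:] ^ n dvd to_t11 x}"
    by (rule Idl_minimal[OF type_idealI]) (auto simp: to_t11_add to_t11_mult assms to_t11_tvar to_t11_idem)
  ultimately show "[:0, 1:] ^ n dvd to_t11 x" by blast
next
  assume x: "[:0, 1:] ^ n dvd to_t11 x"
  have L: "ideal ?L free_ring" by (rule ideal_Idl)
  have gens: "J \<subseteq> ?L" "tvar T12 \<in> ?L" "tvar T21 \<in> ?L" "idem N2 \<in> ?L"
    using mem_Idl_gen[of _ "J \<union> {tvar T12, tvar T21, idem N2}"] by blast+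
  show "x \<in> ?L"
  proof (rule ideal_if_words[OF L])
    fix i ws assume coeff: "word_coeff x (i, ws) \<noteq> 0"
    show "word i ws \<in> ?L"
    proof (rule ccontr)
      assume out: "word i ws \<notin> ?L"
      then have iw: "i = N1" "ws = replicate (length ws) T11"
        using word_T11_or_killed[OF L gens(2-4)] by blast+
      then have "coeff (to_t11 x) (length ws) \<noteq> 0"
        using coeff by (simp add: coeff_to_t11)
      then have "n \<le> length ws" using x by (metis X_power_dvd_iff not_le)
      then have "word i ws \<in> aug_pow n"
        by (auto simp: aug_pow_eq_order_ge order_ge_def word.rep_eq)
      then show False using assms(1) gens(1) out by blast
    qed
  qed
qed

text \<open>
  The image in \<open>k[t\<^sub>1\<^sub>1][x]\<close>, on which \<open>y\<close> acts as \<open>- t\<^sub>1\<^sub>1 x\<close>.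
\<close>
definition rep_line :: "'k::field rep \<Rightarrow> 'k poly poly" where
  "rep_line m = map_poly to_t11 (fst m)"

lemma coeff_rep_line: "coeff (rep_line m) n = to_t11 (coeff (fst m) n)"
  by (simp add: rep_line_def coeff_map_poly)

lemma rep_line_add: "rep_line (m + m') = rep_line m + rep_line m'"
  by (simp add: poly_eq_iff coeff_rep_line to_t11_add)

lemma rep_line_diff: "rep_line (m - m') = rep_line m - rep_line m'"
  by (simp add: poly_eq_iff coeff_rep_line to_t11_diff)

lemma rep_line_0 [simp]: "rep_line 0 = 0"
  by (simp add: rep_line_def)

lemma rep_line_lsmult: "rep_line (s \<bullet> m) = [:to_t11 s:] * rep_line m"
  by (simp add: poly_eq_iff coeff_rep_line) (simp add: rep_line_def lsmult_def coeff_map_poly to_t11_mult)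

lemma rep_line_opx: "rep_line (opx m) = pCons 0 (rep_line m)"
  by (simp add: poly_eq_iff coeff_rep_line coeff_pCons)
    (simp add: opx_def coeff_pCons to_t11_minus to_t11_mult to_t11_tvar coeff_rep_line split: nat.split)

lemma rep_line_y1: "rep_line y1 = - [:0, [:0, 1:]:]"
  by (simp add: rep_line_def y1_def map_poly_pCons to_t11_minus to_t11_tvar)

lemma rep_line_y2: "rep_line y2 = 0"
  by (simp add: rep_line_def y2_def map_poly_pCons to_t11_mult to_t11_tvar)

lemma rep_line_opy: "rep_line (opy m) = - [:0, [:0, 1:]:] * rep_line m"
proof -
  have "rep_line (horner (\<lambda>c. c \<bullet> y1) opx p) = - [:0, [:0, 1:]:] * map_poly to_t11 p"
    for p :: "'a free_alg poly"
  proof (induction p)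
    case (pCons c p)
    then show ?case
      by (simp add: horner_pCons lsmult_simps rep_line_add rep_line_lsmult rep_line_opx rep_line_y1
          map_poly_pCons del: mult_pCons_left) (simp add: algebra_simps)
  qed simp
  then show ?thesis
    by (simp add: opy_def rep_line_add rep_line_lsmult rep_line_y2 rep_line_def[of m])
qed

abbreviation const_t11 :: "'k::field poly poly \<Rightarrow> 'k poly poly poly" where
  "const_t11 a \<equiv> map_poly (map_poly (\<lambda>c. [:c:])) a"

abbreviation eval_line :: "'k::field poly poly poly \<Rightarrow> 'k poly poly" where
  "eval_line b \<equiv> poly b (- [:0, [:0, 1:]:])"

lemma rep_line_act_x: "rep_line (act_x p m) = map_poly (\<lambda>c. [:c:]) p * rep_line m"
  by (induction p) (simp_all add: act_x_pCons rep_line_add rep_line_lsmult rep_line_opx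
      to_t11_scalar map_poly_pCons)

lemma rep_line_act: "rep_line (act a m) = rep_line m * eval_line (const_t11 a)"
  by (induction a) (simp_all add: act_pCons rep_line_add rep_line_opy rep_line_act_x map_poly_pCons
      algebra_simps)

lemma rep_line_surj: "\<exists>m. rep_line m = q"
proof -
  have t: "\<exists>s. to_t11 s = p" for p :: "'a poly"
  proof (induction p)
    case 0
    then show ?case by (intro exI[of _ 0]) simp
  next
    case (pCons c p)
    then obtain s where "to_t11 s = p" by blast
    then have "to_t11 (scalar c + tvar T11 * s) = pCons c p"
      by (simp add: to_t11_add to_t11_mult to_t11_scalar to_t11_tvar)
    then show ?case by blast
  qed
  show ?thesis
  proof (induction q)
    case 0
    then show ?case by (intro exI[of _ 0]) simp
  next
    case (pCons c q)
    then obtain m where "rep_line m = q" by blast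
    moreover obtain s where "to_t11 s = c" using t by blast
    ultimately have "rep_line (pCons s (fst m), 0) = pCons c q"
      by (simp add: rep_line_def map_poly_pCons)
    then show ?case by blast
  qed
qed

text \<open>
  Dividing by the monic polynomial \<open>y + t\<^sub>1\<^sub>1 x\<close> in \<open>y\<close> identifies the family of lines with
  \<open>(k[t\<^sub>1\<^sub>1]/(t\<^sub>1\<^sub>1\<^sup>n))[x]\<close>.
\<close>
lemma mem_line_ideal_iff:
  "b \<in> line_ideal n [:0, 1:] \<longleftrightarrow> [:[:0, 1:] ^ n:] dvd eval_line (b :: 'k::field poly poly poly)"
proof
  have const_power: "[:c:] ^ n = [:c ^ n:]" for c :: "'a::comm_ring_1"
    by (induction n) (auto simp: one_pCons)
  let ?G = "{[:[:[:0, 1:]:]:] ^ n, [:0, 1:] + [:[:[:0, 1:]:]:] * [:[:0, 1:]:]} :: 'k poly poly poly set"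
  {
    assume "b \<in> line_ideal n [:0, 1:]"
    moreover have "line_ideal n [:0, 1:] \<subseteq> {b. [:[:0, 1:] ^ n:] dvd eval_line (b :: 'k poly poly poly)}"
      unfolding line_ideal_def
      by (rule Idl_minimal[OF type_idealI]) (auto simp: const_power)
    ultimately show "[:[:0, 1:] ^ n:] dvd eval_line b" by blast
  next
    assume "[:[:0, 1:] ^ n:] dvd eval_line b"
    then obtain q where q: "eval_line b = [:[:0, 1:] ^ n:] * q" by (elim dvdE)
    have "eval_line (b - [:eval_line b:]) = 0" by simp
    then obtain r where r: "b - [:eval_line b:] = [:- (- [:0, [:0, 1:]:]), 1:] * r"
      by (metis dvdE poly_eq_0_iff_dvd)
    then have "b = ([:0, 1:] + [:[:[:0, 1:]:]:] * [:[:0, 1:]:]) * r + [:eval_line b:]"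
      by (simp add: algebra_simps)
    also have "[:eval_line b:] = [:[:[:0, 1:]:]:] ^ n * [:q:]"
      unfolding q by (simp add: const_power)
    finally have b: "b = ([:0, 1:] + [:[:[:0, 1:]:]:] * [:[:0, 1:]:]) * r + [:[:[:0, 1:]:]:] ^ n * [:q:]" .
    have G: "ideal (Idl\<^bsub>ring_of_type_algebra\<^esub> ?G) ring_of_type_algebra"
      by (rule ideal_Idl)
    show "b \<in> line_ideal n [:0, 1:]"
      unfolding line_ideal_def
      by (subst b, intro ideal_add[OF G] ideal_rmult[OF G] mem_Idl_gen) auto
  }
qed

lemma ideal_line_ideal: "ideal (line_ideal n u) ring_of_type_algebra"
  unfolding line_ideal_def by (rule ideal_Idl)

text \<open>
  The substitution \<open>t\<^sub>1\<^sub>1 = 0\<close> on \<open>k[t\<^sub>1\<^sub>1][x]\<close>.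
\<close>
definition special_fibre :: "'k::field poly poly \<Rightarrow> 'k poly" where
  "special_fibre q = map_poly (\<lambda>p. poly p 0) q"

lemma coeff_special_fibre: "coeff (special_fibre q) n = poly (coeff q n) 0"
  by (simp add: special_fibre_def coeff_map_poly)

lemma special_fibre_hom:
  "special_fibre 0 = 0" "special_fibre (p + q) = special_fibre p + special_fibre q"
  "special_fibre (p * q) = special_fibre p * special_fibre q"
  by (simp_all add: poly_eq_iff coeff_special_fibre coeff_mult poly_sum)

lemma special_fibre_line_ideal:
  assumes "n \<noteq> 0" "b \<in> line_ideal n [:0, 1:]"
  shows "special_fibre (poly b 0) = 0"
proof -
  have "line_ideal n [:0, 1:] \<subseteq> {b :: 'a poly poly poly. special_fibre (poly b 0) = 0}"
    unfolding line_ideal_def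
  proof (intro Idl_minimal[OF type_idealI])
    obtain m where n: "n = Suc m" using assms(1) by (cases n) auto
    have t: "special_fibre [:[:0, 1:] :: 'a poly:] = 0"
      by (simp add: special_fibre_def map_poly_pCons)
    show "{[:[:[:0, 1:]:]:] ^ n, [:0, 1:] + [:[:[:0, 1:]:]:] * [:[:0, 1:]:]}
        \<subseteq> {b :: 'a poly poly poly. special_fibre (poly b 0) = 0}"
      by (simp add: n special_fibre_hom t del: mult_pCons_left mult_pCons_right)
  qed (auto simp: special_fibre_hom)
  then show ?thesis using assms(2) by blast
qed

lemma universal_line_condition:
  fixes J :: "'k::field free_alg set"
  assumes J: "relations_ideal J" "J \<subseteq> aug" "aug_pow n \<subseteq> J"
    and t11: "\<And>j. j \<in> J \<Longrightarrow> [:0, 1:] ^ n dvd to_t11 j" and n: "n \<noteq> 0"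
  shows "line_condition n J (universal J)"
proof -
  interpret J: relations_ideal J by fact
  let ?L = "Idl\<^bsub>free_ring\<^esub> (J \<union> {tvar T12, tvar T21, idem N2})"
  let ?B = "ring_of_type_algebra :: 'k poly poly poly ring"
  let ?u = "[:0, 1:] :: 'k poly"
  let ?I = "line_ideal n ?u" and ?N = "line_family n ?u"
  define h where "h m = ?I +>\<^bsub>?B\<^esub> [:rep_line m:]" for m :: "'k rep"
  note I = ideal_line_ideal[of n ?u]
  note quot = quot_simps[OF I]
  have ker: "x \<in> ?L \<longleftrightarrow> [:0, 1:] ^ n dvd to_t11 x" for x
    by (rule line_kernel[OF J(3) t11])
  have h_eq: "h m = h m' \<longleftrightarrow> m - m' \<in> subrep ?L" for m m'
  proof -
    have "[:rep_line m:] - [:rep_line m':] = [:rep_line (m - m'):]"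
      by (simp add: rep_line_diff)
    then have "h m = h m' \<longleftrightarrow> [:[:0, 1:] ^ n:] dvd rep_line (m - m')"
      by (simp add: h_def coset_eq_iff[OF I] mem_line_ideal_iff)
    also have "\<dots> \<longleftrightarrow> m - m' \<in> subrep ?L"
      unfolding subrep_def mem_Collect_eq ker
      by (simp add: const_poly_dvd_iff coeff_rep_line to_t11_mult to_t11_idem del: fst_diff snd_diff)
    finally show ?thesis .
  qed
  have cls: "?I +>\<^bsub>?B\<^esub> b = ?I +>\<^bsub>?B\<^esub> [:eval_line b:]" for b
    by (simp add: coset_eq_iff[OF I] mem_line_ideal_iff)
  have "J \<subseteq> ?L" by (auto intro: mem_Idl_gen)
  note bc = J.base_change_universal[OF ideal_Idl this h_eq, of ?N]
  have surj: "range h = carrier ?N"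
  proof -
    have "?I +>\<^bsub>?B\<^esub> b \<in> range h" for b
    proof -
      obtain m where "rep_line m = eval_line b" using rep_line_surj by blast
      then have "?I +>\<^bsub>?B\<^esub> b = h m" by (simp add: cls[of b] h_def)
      then show ?thesis by blast
    qed
    then show ?thesis
      by (auto simp: line_family_def Let_def quot h_def)
  qed
  have act: "h (act a m) = h m \<triangleleft>\<^bsub>?N\<^esub> a" for a m
    by (simp add: line_family_def Let_def quot h_def coset_eq_iff[OF I] mem_line_ideal_iff rep_line_act)
  have lift: "h (lift_rep J (tcls J m)) = h m" for m
    by (rule bc(1)) (simp_all add: surj act, simp_all add: line_family_def Let_def quot h_def rep_line_add rep_line_lsmult)
  have base: "base_change ?L (universal J) ?N (\<lambda>t. h (lift_rep J t))"
    by (rule bc(2)) (simp_all add: surj act, simp_all add: line_family_def Let_def quot h_def rep_line_add rep_line_lsmult)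
  have "special_fibre (poly b 0) = fst (reduce m)" if "b \<in> h m" for b m
  proof -
    have "b - [:rep_line m:] \<in> ?I"
      using that by (simp add: h_def mem_coset_iff)
    then have "special_fibre (poly (b - [:rep_line m:]) 0) = 0"
      by (rule special_fibre_line_ideal[OF n])
    moreover have "special_fibre (rep_line m) = fst (reduce m)"
      by (simp add: poly_eq_iff coeff_special_fibre coeff_reduce coeff_rep_line poly_0_coeff_0 coeff_to_t11)
    ultimately show ?thesis
      using special_fibre_hom(2)[of "poly (b - [:rep_line m:]) 0" "rep_line m"] by simp
  qed
  then have "\<forall>b\<in>h (lift_rep J (tcls J m)).
      map_poly (\<lambda>p. poly p 0) (poly b 0) = fst (toV (universal J) (tcls J m))" for m
    unfolding lift J.toV_universal[OF J(2)] special_fibre_def by blast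
  then have "\<forall>t\<in>carrier (universal J). \<forall>b\<in>h (lift_rep J t).
      map_poly (\<lambda>p. poly p 0) (poly b 0) = fst (toV (universal J) t)"
    unfolding J.universal_simps(1) by blast
  with base show ?thesis
    unfolding line_condition_def by blast
qed


section \<open>First order part\<close>

lemma rows: "{a. row a = N1} = {T11, T12}" "{a. row a = N2} = {T21, T22_1, T22_2}"
  by (auto, metis gen.exhaust row.simps idx.distinct, metis gen.exhaust row.simps idx.distinct)

text \<open>
  The obvious lifts of the cochains \<open>tangent a\<close>. With these the relations of the perturbed
  differential hold exactly, except for the correction term \<open>t\<^sub>2\<^sub>1 t\<^sub>1\<^sub>1 v\<^sub>1\<close>, which lies in \<open>\<mm>\<^sup>2\<close>.
\<close>
primrec tangent_rep :: "gen \<Rightarrow> nat \<Rightarrow> 'k::field rep" where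
  "tangent_rep T11 = (\<lambda>r. ([:0, 1:], 0))"
| "tangent_rep T12 = (\<lambda>r. (0, 1))"
| "tangent_rep T21 = (\<lambda>r. if r = 0 then ([:1:], 0) else 0)"
| "tangent_rep T22_1 = (\<lambda>r. if r = 0 then (0, 1) else 0)"
| "tangent_rep T22_2 = (\<lambda>r. if r = 1 then (0, 1) else 0)"

lemma universal_first_order:
  fixes J :: "'k::field free_alg set"
  assumes J: "relations_ideal J" "J \<subseteq> aug" "aug_pow 2 \<subseteq> J"
  shows "first_order (universal J)"
proof -
  interpret J: relations_ideal J by fact
  interpret M: free_bimodule "universal J" by (rule J.universal_free_bimodule)
  define v where "v i = tcls J (case i of N1 \<Rightarrow> ([:1:], 0) | N2 \<Rightarrow> (0, 1))" for i
  define w where "w a r = tcls J (tangent_rep a r)" for a r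
  note toV = J.toV_universal[OF J(2)]
  have carr: "tcls J m \<in> carrier (universal J)" for m by (simp add: J.universal_simps)
  have v: "v i \<in> carrier (universal J)" "idem i \<odot>\<^bsub>universal J\<^esub> v i = v i" for i
    using ideal_zero[OF J.ideal_L]
    by (cases i; auto simp: v_def carr J.universal_simps J.tcls_eq_iff subrep_def lsmult_def map_poly_pCons
        coeff_pCons left_diff_distrib split: nat.split)+
  have toV_v: "toV (universal J) (v N1) = (1, 0)" "toV (universal J) (v N2) = (0, 1)"
    by (simp_all add: v_def toV reduce_def map_poly_pCons one_free_alg.rep_eq one_pCons)
  have \<zeta>: "tangent a \<in> ext1_class (row a) (col a) (tangent a :: nat \<Rightarrow> 'k poly \<times> 'k)" for a
  proof -
    have "0 \<in> partV (col a)" by (cases "col a") (auto simp: zero_prod_def)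
    then show ?thesis
      unfolding ext1_class_def
      by (auto simp: tangent_cocycle actV_def simp flip: zero_prod_def intro!: bexI[of _ 0])
  qed
  have w: "w a r \<in> carrier (universal J)" "toV (universal J) (w a r) = tangent a r" for a r
    by (simp add: w_def carr, cases a)
      (auto simp: w_def toV reduce_def map_poly_pCons one_free_alg.rep_eq one_pCons zero_prod_def)
  have "tvar T21 * tvar T11 \<in> aug_pow (1 + 1)"
    by (rule aug_pow_mult_aug) (auto simp: aug_pow_eq_order_ge aug_gen simp flip: aug_eq_order_ge One_nat_def)
  then have t: "tvar T21 * tvar T11 \<in> J" using J(3) by (auto simp: numeral_2_eq_2)
  have rel: "v i \<triangleleft>\<^bsub>universal J\<^esub> d1 i r \<oplus>\<^bsub>universal J\<^esub>
      (\<Oplus>\<^bsub>universal J\<^esub>a\<in>{a. row a = i}. tvar a \<odot>\<^bsub>universal J\<^esub> w a r) = \<zero>\<^bsub>universal J\<^esub>"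
    if "r < rk1 i" for i r
  proof (cases i)
    case N1
    then show ?thesis
      by (simp add: rows M.finsum_insert M.smult_closed w(1) Pi_def)
        (simp add: v_def w_def J.universal_ract J.universal_simps act_yA J.tcls_eq_iff,
         simp add: opy_def lsmult_simps horner_pCons,
         simp add: lsmult_def y1_def map_poly_pCons flip: zero_prod_def)
  next
    case N2
    with that have "r = 0 \<or> r = 1" by auto
    with N2 show ?thesis
      using t ideal_zero[OF J.ideal_L]
      by (auto simp: rows M.finsum_insert M.smult_closed w(1) Pi_def)
        (auto simp: v_def w_def J.universal_ract J.universal_simps act_yA act_xA J.tcls_eq_iff
          opy_def opx_def lsmult_def y2_def map_poly_pCons subrep_def coeff_pCons ideal_rmult[OF J.ideal_L] split: nat.split)
  qed
  show ?thesis
    unfolding first_order_def using v toV_v \<zeta> w rel by blast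
qed


section \<open>The obstruction calculus for the universal family\<close>

abbreviation rel_ideal :: "'k::field free_alg set" where
  "rel_ideal \<equiv> Idl\<^bsub>free_ring\<^esub> {rel_point, rel_line}"

definition truncation :: "nat \<Rightarrow> 'k::field free_alg set" where
  "truncation n = rel_ideal <+>\<^bsub>free_ring\<^esub> aug_pow n"

lemma aug_pow_antimono: "m \<le> n \<Longrightarrow> aug_pow n \<subseteq> aug_pow m"
  by (auto simp: aug_pow_eq_order_ge order_ge_def)

lemma aug_pow_2_subset: "aug_pow 2 \<subseteq> aug"
  by (auto simp: aug_pow_eq_order_ge aug_eq_order_ge order_ge_def)

lemma rel_ideal_subset: "rel_ideal \<subseteq> aug_pow 2"
proof (rule Idl_minimal[OF ideal_aug_pow])
  note I = ideal_order_ge[of 2]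
  have t: "tvar a \<in> order_ge 1" for a
    using aug_gen by (simp add: aug_eq_order_ge)
  have tt: "tvar a * tvar b \<in> order_ge 2" for a b
    using order_ge_mult[OF t t, of a b] by (simp add: numeral_2_eq_2)
  have "rel_point \<in> order_ge 2" "rel_line \<in> order_ge 2"
    unfolding rel_point_def rel_line_def
    by (intro ideal_diff[OF I] ideal_add[OF I] ideal_rmult[OF I, of "_ * _"] tt)+
  then show "{rel_point, rel_line} \<subseteq> aug_pow 2"
    by (simp add: aug_pow_eq_order_ge)
qed

lemma subset_set_add:
  assumes "ideal I ring_of_type_algebra" "ideal J ring_of_type_algebra"
  shows "I \<subseteq> I <+>\<^bsub>ring_of_type_algebra\<^esub> (J :: 'a::ring_1 set)"
    and "J \<subseteq> I <+>\<^bsub>ring_of_type_algebra\<^esub> J"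
  using ideal_zero[OF assms(1)] ideal_zero[OF assms(2)] by (force simp: mem_set_add_iff)+

lemma set_add_subset:
  assumes "ideal K ring_of_type_algebra" "I \<subseteq> K" "J \<subseteq> K"
  shows "I <+>\<^bsub>ring_of_type_algebra\<^esub> J \<subseteq> (K :: 'a::ring_1 set)"
  using assms by (auto simp: mem_set_add_iff intro!: ideal_add[OF assms(1)])

lemmas ideal_truncation_parts = ideal_Idl[of "{rel_point, rel_line}"] ideal_aug_pow

lemma ideal_truncation: "ideal (truncation n) free_ring"
  unfolding truncation_def by (intro ideal_set_add ideal_truncation_parts)

lemma rel_ideal_subset_truncation: "rel_ideal \<subseteq> truncation n"
  and aug_pow_subset_truncation: "aug_pow n \<subseteq> truncation n"
  unfolding truncation_def by (intro subset_set_add ideal_truncation_parts)+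

lemma truncation_relations: "relations_ideal (truncation n)"
  using rel_ideal_subset_truncation[of n] ideal_truncation[of n]
    mem_Idl_gen[of _ "{rel_point, rel_line}"]
  unfolding relations_ideal_def relations_ideal_axioms_def two_sided_ideal_def by blast

lemma truncation_2: "truncation 2 = aug_pow 2"
  using aug_pow_subset_truncation[of 2]
    set_add_subset[OF ideal_aug_pow rel_ideal_subset subset_refl]
  by (auto simp: truncation_def)

lemma truncation_antimono: "m \<le> n \<Longrightarrow> truncation n \<subseteq> truncation m"
  using rel_ideal_subset_truncation[of m] aug_pow_subset_truncation[of m] aug_pow_antimono[of m n]
    set_add_subset[OF ideal_truncation, of rel_ideal m "aug_pow n"]
  by (auto simp: truncation_def)

lemma truncation_subset_aug: "2 \<le> n \<Longrightarrow> truncation n \<subseteq> aug"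
  using truncation_antimono[of 2 n] truncation_2 aug_pow_2_subset by blast

lemma truncation_to_t11:
  fixes j :: "'k::field free_alg"
  assumes "j \<in> truncation n"
  shows "[:0, 1:] ^ n dvd to_t11 j"
proof -
  from assms obtain a b where j: "j = a + b" "a \<in> rel_ideal" "b \<in> aug_pow n"
    by (auto simp: truncation_def mem_set_add_iff)
  have "rel_ideal \<subseteq> {a :: 'k free_alg. to_t11 a = 0}"
    by (rule Idl_minimal[OF type_idealI])
      (auto simp: to_t11_add to_t11_diff to_t11_mult rel_point_def rel_line_def to_t11_tvar)
  then have "to_t11 a = 0" using j by blast
  moreover have "[:0, 1:] ^ n dvd to_t11 b"
    using j by (auto simp: X_power_dvd_iff coeff_to_t11 aug_pow_eq_order_ge order_ge_def)
  ultimately show ?thesis by (simp add: j to_t11_add)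
qed

text \<open>
  The relations already lie in \<open>J\<^bsub>n+1\<^esub>\<close>, and multiplication with \<open>\<mm>\<close> moves \<open>\<mm>\<^sup>n\<close> into \<open>\<mm>\<^bsup>n+1\<^esup>\<close>.
\<close>
lemma truncation_small: "truncation (n + 1) \<in> small_ideals (truncation n) n"
proof -
  let ?K = "truncation (n + 1)"
  note K = ideal_truncation[of "n + 1"]
  have "s * j \<in> ?K \<and> j * s \<in> ?K" if "s \<in> aug" "j \<in> truncation n" for s j
  proof -
    from that obtain a b where j: "j = a + b" "a \<in> rel_ideal" "b \<in> aug_pow n"
      by (auto simp: truncation_def mem_set_add_iff)
    have a: "a \<in> ?K" using j rel_ideal_subset_truncation by blast
    have "s * b \<in> aug_pow (n + 1)" "b * s \<in> aug_pow (n + 1)"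
      using that(1) j(3) order_ge_mult[of s 1 b n] order_ge_mult[of b n s 1]
      by (simp_all only: aug_eq_order_ge aug_pow_eq_order_ge add.commute)
    then have b: "s * b \<in> ?K" "b * s \<in> ?K"
      using aug_pow_subset_truncation by blast+
    show ?thesis
      unfolding j distrib_left distrib_right
      using ideal_add[OF K ideal_lmult[OF K a] b(1)] ideal_add[OF K ideal_rmult[OF K a] b(2)] by blast
  qed
  then have "aug \<cdot>\<^bsub>free_ring\<^esub> truncation n \<subseteq> ?K" "truncation n \<cdot>\<^bsub>free_ring\<^esub> aug \<subseteq> ?K"
    by (intro ideal_prod_subset[OF K]; blast)+
  then have "aug_pow (n + 1) <+>\<^bsub>free_ring\<^esub> (aug \<cdot>\<^bsub>free_ring\<^esub> truncation n)
      <+>\<^bsub>free_ring\<^esub> (truncation n \<cdot>\<^bsub>free_ring\<^esub> aug) \<subseteq> ?K"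
    by (intro set_add_subset[OF K] aug_pow_subset_truncation)
  then show ?thesis
    using K truncation_antimono[of n "n + 1"] by (simp add: small_ideals_def)
qed

lemma small_ideals_bounds:
  assumes "I \<in> small_ideals J n" "ideal J free_ring"
  shows "aug_pow (n + 1) \<subseteq> I"
    and "s \<in> aug \<Longrightarrow> j \<in> J \<Longrightarrow> s * j \<in> I \<and> j * s \<in> I"
proof -
  have l: "ideal (aug \<cdot>\<^bsub>free_ring\<^esub> J) free_ring" and r: "ideal (J \<cdot>\<^bsub>free_ring\<^esub> aug) free_ring"
    by (intro ideal_prod_ideal ideal_aug assms)+
  note p = ideal_aug_pow[of "n + 1"]
  have "aug_pow (n + 1) <+>\<^bsub>free_ring\<^esub> (aug \<cdot>\<^bsub>free_ring\<^esub> J) <+>\<^bsub>free_ring\<^esub> (J \<cdot>\<^bsub>free_ring\<^esub> aug) \<subseteq> I"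
    using assms(1) by (simp only: small_ideals_def mem_Collect_eq)
  then have sub: "aug_pow (n + 1) \<subseteq> I" "aug \<cdot>\<^bsub>free_ring\<^esub> J \<subseteq> I" "J \<cdot>\<^bsub>free_ring\<^esub> aug \<subseteq> I"
    using subset_set_add[OF p l] subset_set_add[OF ideal_set_add[OF p l] r] by blast+
  then show "aug_pow (n + 1) \<subseteq> I" by blast
  show "s * j \<in> I \<and> j * s \<in> I" if "s \<in> aug" "j \<in> J"
    using sub(2,3) ideal_prod_mem[of s aug j J] ideal_prod_mem[of j J s aug] that by blast
qed

lemma truncation_minimal:
  assumes n: "n \<ge> 2" and I: "I \<in> small_ideals (truncation n) n"
    and lifts: "lifts_to (truncation n) (universal (truncation n)) I M"
  shows "truncation (n + 1) \<subseteq> I"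
proof -
  have ideal: "ideal I free_ring" and sub: "I \<subseteq> truncation n"
    using I by (auto simp: small_ideals_def)
  note bounds = small_ideals_bounds[OF I ideal_truncation]
  note forced = relations_forced[OF truncation_relations truncation_subset_aug[OF n] ideal sub bounds(2) lifts]
  have "rel_line * idem N1 \<in> I"
    using forced[of "\<lambda>v. coeff (fst v) 0" N1]
    by (simp add: moduleV_def actV_def coeff_mult scalar_simps coeff_pCons)
  moreover have "rel_point * idem N2 \<in> I"
    using forced[of snd N2] by (simp add: moduleV_def actV_def scalar_simps)
  ultimately have "{rel_point, rel_line} \<subseteq> I"
    by (simp add: rel_point_def rel_line_def left_diff_distrib distrib_right)
  then show ?thesis
    unfolding truncation_def
    by (intro set_add_subset[OF ideal] bounds(1) Idl_minimal[OF ideal])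
qed

lemma obstruction_calculus_universal:
  "obstruction_calculus truncation (\<lambda>n. universal (truncation n))"
proof -
  have deform: "deformation (truncation n) (universal (truncation n))" if "n \<ge> 2" for n
    by (rule relations_ideal.universal_deformation[OF truncation_relations truncation_subset_aug[OF that]])
  have lifts: "lifts_to (truncation n) (universal (truncation n))
      (truncation (n + 1)) (universal (truncation (n + 1)))" if "n \<ge> 2" for n
    using that by (intro universal_lifts truncation_relations truncation_antimono truncation_subset_aug) auto
  have "first_order (universal (truncation 2))"
    by (intro universal_first_order truncation_relations truncation_subset_aug aug_pow_subset_truncation) simp
  moreover have "line_condition n (truncation n) (universal (truncation n))" if "n \<ge> 2" for n
    using that by (intro universal_line_condition truncation_relations truncation_subset_aug
        aug_pow_subset_truncation truncation_to_t11) auto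
  ultimately show ?thesis
    unfolding obstruction_calculus_def obstruction_vanishes_def
    using truncation_2 deform[of 2] truncation_small lifts truncation_minimal
    by (intro conjI allI impI ballI) blast+
qed

theorem proposition1:
  shows "versal_base_space
    (free_ring Quot Idl\<^bsub>free_ring\<^esub>
       {tvar T22_2 * tvar T22_1 - tvar T22_1 * tvar T22_2 - tvar T21 * tvar T12,
        tvar T22_2 * tvar T21 + tvar T22_1 * tvar T21 * tvar T11}
     :: 'k::{alg_closed_field, field_char_0} free_alg set ring)"
proof -
  have "versal_ideal (rel_ideal :: 'k free_alg set)"
    unfolding versal_ideal_def truncation_def[symmetric]
    using ideal_Idl rel_ideal_subset obstruction_calculus_universal by blast
  then show ?thesis
    unfolding versal_base_space_def rel_point_def rel_line_def by blast
qed

end
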